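(* Let $\tau$ be a veering ideal triangulation of $M$. Then $\tau$ admits a positive angle structure $(\theta)$, whose angles satisfy, for all $i$, $$\theta_i \;\geq\; \frac{\pi}{12\, d_{\max}^2} \;\geq\; \frac{\pi}{12\,(e_{\max}-3)^2},$$ where $d_{\max}$ is the maximum number of triangles in a fan of any vertex $v\in\partial\overline{M}$, and $e_{\max}$ is the largest degree of an edge of $\tau$.
   Context: Ideal triangulations. $\overline{M}$ is a compact oriented 3-manifold whose boundary is a nonempty union of tori, decomposed into finitely many truncated tetrahedra $\Delta_1,\dots,\Delta_n$ glued in pairs along all their hexagonal faces. The boundary (cusp) triangles obtained by truncating the tips remain unglued and give a (possibly non-simplicial) triangulation of $\partial\overline{M}$. Then $\tau=\{\Delta_1,\dots,\Delta_n\}$ is called an ideal triangulation of $M=\overline{M}\smallsetminus\partial\overline{M}$. An edge of $\tau$ (or of $M$) means an interior edge, i.e. one not contained in $\partial\overline{M}$; its endpoints are vertices of the triangulation of $\partial\overline{M}$. The degree of an edge is the number of tetrahedron edges (dihedral angles) around it, counted with multiplicity. Angle structures. Assign a real variable $\theta_j$ (an angle) to every pair of opposite edges of every tetrahedron, so that $\Delta_i$ has angles $\theta_{3i-2},\theta_{3i-1},\theta_{3i}$. Impose: (1) $\theta_{3i-2}+\theta_{3i-1}+\theta_{3i}=\pi$ for each $i$; (2) for each edge of $M$, the angles around it (with multiplicity) sum to $2\pi$. A vector $(\theta)\in\mathbb{R}^{3n}$ satisfying (1) and (2) is a generalized angle structure; it is a taut angle structure if all $\theta_j\in\{0,\pi\}$,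 and a positive angle structure if all $\theta_j>0$. Each corner of a boundary triangle carries the angle of the tetrahedron edge it truncates. Fans and veering. Given a taut angle structure, every boundary triangle has angles $(0,0,\pi)$. The link of every vertex $v$ of $\partial\overline{M}$ consists of two $\pi$-angles separated by two (possibly empty) sequences of $0$-angles; these two sequences of $0$-angled triangle corners are the two fans of $v$. The taut angle structure is veering if for every vertex $v$ of $\partial\overline{M}$, either all triangles of the two fans of $v$ have their $\pi$-angle immediately before $v$ in the counterclockwise cyclic order on the vertices of the triangle, or all triangles of the two fans of $v$ have their $\pi$-angle immediately after $v$ in this order ($\partial\overline{M}$ is oriented by the orientation of $M$). A veering ideal triangulation is an ideal triangulation equipped with a veering taut angle structure; fans are taken with respect to this structure. *)

theory Defs
  imports "HOL-Analysis.Analysis" "HOL-Combinatorics.Permutations"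
begin

section \<open>Oriented ideal triangulations\<close>

text \<open>
  The tetrahedra are numbered by the \<open>t < tets \<tau>\<close>, and every tetrahedron has vertices 0, 1, 2, 3.
  Face \<open>f\<close> of a tetrahedron is the one opposite to vertex \<open>f\<close>. Face \<open>f\<close> of tetrahedron \<open>t\<close> is glued
  to a face of tetrahedron \<open>nbr \<tau> t f\<close>: with \<open>\<sigma> = glue \<tau> t f\<close>, vertex \<open>v \<noteq> f\<close> of \<open>t\<close> goes to
  vertex \<open>\<sigma> v\<close>, and the target face is \<open>\<sigma> f\<close>.
\<close>

record triangulation =
  tets :: nat
  nbr :: "nat \<Rightarrow> nat \<Rightarrow> nat"
  glue :: "nat \<Rightarrow> nat \<Rightarrow> nat \<Rightarrow> nat"

text \<open>
  All faces are glued in pairs. The vertices of every tetrahedron are numbered compatibly with the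
  orientation of the manifold, so that gluings reverse orientation exactly if \<open>glue \<tau> t f\<close> is odd.
  Since no face is glued to itself and gluings reverse orientation, no edge gets identified with
  its own reverse. Hence the space glued from the truncated tetrahedra is always
  a compact oriented 3-manifold whose boundary is made of the cusp triangles.
\<close>

definition oriented_gluing :: "triangulation \<Rightarrow> bool" where
  "oriented_gluing \<tau> \<longleftrightarrow>
     (\<forall>t<tets \<tau>. \<forall>f<4.
        nbr \<tau> t f < tets \<tau> \<and>
        glue \<tau> t f permutes {..<4} \<and> \<not> evenperm (glue \<tau> t f) \<and>
        (nbr \<tau> t f, glue \<tau> t f f) \<noteq> (t, f) \<and>
        nbr \<tau> (nbr \<tau> t f) (glue \<tau> t f f) = t \<and>
        glue \<tau> (nbr \<tau> t f) (glue \<tau> t f f) = inv (glue \<tau> t f))"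

subsection \<open>The manifold and its boundary\<close>

text \<open>
  Barycentric coordinates. Vertex \<open>v\<close> is cut off along \<open>x v = 2/3\<close>; the hexagonal face \<open>f\<close>
  is \<open>x f = 0\<close>.
\<close>

definition truncated_tetrahedron :: "(nat \<Rightarrow> real) set" where
  "truncated_tetrahedron =
     {x. (\<forall>v. 0 \<le> x v \<and> x v \<le> 2/3) \<and> (\<forall>v\<ge>4. x v = 0) \<and> (\<Sum>v<4. x v) = 1}"

definition tetrahedra_space :: "triangulation \<Rightarrow> (nat \<times> (nat \<Rightarrow> real)) topology" where
  "tetrahedra_space \<tau> =
     prod_topology (discrete_topology {..<tets \<tau>})
       (subtopology (powertop_real UNIV) truncated_tetrahedron)"

definition face_pairing :: "triangulation \<Rightarrow> (nat \<times> (nat \<Rightarrow> real)) rel" where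
  "face_pairing \<tau> = {((t, x), (nbr \<tau> t f, x \<circ> inv (glue \<tau> t f))) | t x f.
     t < tets \<tau> \<and> f < 4 \<and> x \<in> truncated_tetrahedron \<and> x f = 0}"

definition quotient_space :: "'a topology \<Rightarrow> ('a \<Rightarrow> 'b) \<Rightarrow> 'b topology" where
  "quotient_space X q =
     topology (\<lambda>U. U \<subseteq> q ` topspace X \<and> openin X {x \<in> topspace X. q x \<in> U})"

lemma openin_quotient_space:
  "openin (quotient_space X q) U \<longleftrightarrow>
     U \<subseteq> q ` topspace X \<and> openin X {x \<in> topspace X. q x \<in> U}"
proof -
  have "istopology (\<lambda>U. U \<subseteq> q ` topspace X \<and> openin X {x \<in> topspace X. q x \<in> U})"
    unfolding istopology_def
  proof (intro conjI allI impI)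
    fix S T
    assume S: "S \<subseteq> q ` topspace X \<and> openin X {x \<in> topspace X. q x \<in> S}"
       and T: "T \<subseteq> q ` topspace X \<and> openin X {x \<in> topspace X. q x \<in> T}"
    show "S \<inter> T \<subseteq> q ` topspace X" using S by blast
    have "{x \<in> topspace X. q x \<in> S \<inter> T} =
        {x \<in> topspace X. q x \<in> S} \<inter> {x \<in> topspace X. q x \<in> T}" by blast
    then show "openin X {x \<in> topspace X. q x \<in> S \<inter> T}" using S T by auto
  next
    fix \<K>
    assume K: "\<forall>K\<in>\<K>. K \<subseteq> q ` topspace X \<and> openin X {x \<in> topspace X. q x \<in> K}"
    then show "\<Union> \<K> \<subseteq> q ` topspace X" by blast
    have "{x \<in> topspace X. q x \<in> \<Union> \<K>} = (\<Union>K\<in>\<K>. {x \<in> topspace X. q x \<in> K})" by blast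
    then show "openin X {x \<in> topspace X. q x \<in> \<Union> \<K>}" using K by auto
  qed
  then show ?thesis by (simp add: quotient_space_def topology_inverse')
qed

lemma quotient_map_quotient_space: "quotient_map X (quotient_space X q) q"
proof -
  have "topspace (quotient_space X q) = q ` topspace X"
  proof (rule antisym)
    show "topspace (quotient_space X q) \<subseteq> q ` topspace X"
      by (meson openin_quotient_space openin_topspace)
    have "{x \<in> topspace X. q x \<in> q ` topspace X} = topspace X" by blast
    then show "q ` topspace X \<subseteq> topspace (quotient_space X q)"
      by (intro openin_subset) (simp add: openin_quotient_space)
  qed
  then show ?thesis by (auto simp: quotient_map_def openin_quotient_space)
qed

text \<open>For an oriented gluing, \<open>face_pairing\<close> is symmetric, so its reflexive transitive closure is
  the equivalence relation it generates.\<close>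

definition point_class ::
  "triangulation \<Rightarrow> nat \<times> (nat \<Rightarrow> real) \<Rightarrow> (nat \<times> (nat \<Rightarrow> real)) set" where
  "point_class \<tau> p = (face_pairing \<tau>)\<^sup>* `` {p}"

definition compact_manifold :: "triangulation \<Rightarrow> (nat \<times> (nat \<Rightarrow> real)) set topology" where
  "compact_manifold \<tau> = quotient_space (tetrahedra_space \<tau>) (point_class \<tau>)"

definition boundary_surface :: "triangulation \<Rightarrow> (nat \<times> (nat \<Rightarrow> real)) set topology" where
  "boundary_surface \<tau> = subtopology (compact_manifold \<tau>)
     {point_class \<tau> (t, x) | t x. t < tets \<tau> \<and> x \<in> truncated_tetrahedron \<and> (\<exists>v<4. x v = 2/3)}"

definition torus :: "(complex \<times> complex) topology" where
  "torus = prod_topology (top_of_set (sphere 0 1)) (top_of_set (sphere 0 1))"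

definition ideal_triangulation :: "triangulation \<Rightarrow> bool" where
  "ideal_triangulation \<tau> \<longleftrightarrow>
     oriented_gluing \<tau> \<and>
     topspace (boundary_surface \<tau>) \<noteq> {} \<and>
     (\<forall>C \<in> connected_components_of (boundary_surface \<tau>).
        subtopology (boundary_surface \<tau>) C homeomorphic_space torus)"

subsection \<open>Edges\<close>

text \<open>\<open>(t, {a, b})\<close> is the edge of tetrahedron \<open>t\<close> from \<open>a\<close> to \<open>b\<close>. An edge of the triangulation is
  a class of tetrahedron edges under identification across the faces containing them.\<close>

definition tet_edges :: "triangulation \<Rightarrow> (nat \<times> nat set) set" where
  "tet_edges \<tau> = {(t, e). t < tets \<tau> \<and> e \<subseteq> {..<4} \<and> card e = 2}"

definition edge_pairing :: "triangulation \<Rightarrow> (nat \<times> nat set) rel" where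
  "edge_pairing \<tau> = {((t, e), (nbr \<tau> t f, glue \<tau> t f ` e)) | t e f.
     (t, e) \<in> tet_edges \<tau> \<and> f < 4 \<and> f \<notin> e}"

definition edges :: "triangulation \<Rightarrow> (nat \<times> nat set) set set" where
  "edges \<tau> = tet_edges \<tau> // (edge_pairing \<tau>)\<^sup>*"

definition max_degree :: "triangulation \<Rightarrow> nat" where
  "max_degree \<tau> = Max (card ` edges \<tau>)"

section \<open>Angle structures\<close>

text \<open>The angles of tetrahedron \<open>t\<close> are \<open>\<theta> (3 * t)\<close>, \<open>\<theta> (3 * t + 1)\<close>, \<open>\<theta> (3 * t + 2)\<close>, one for
  each pair of opposite edges.\<close>

definition opposite_pair :: "nat set \<Rightarrow> nat" where
  "opposite_pair e =
     (if e \<in> {{0, 1}, {2, 3}} then 0 else if e \<in> {{0, 2}, {1, 3}} then 1 else 2)"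

definition edge_angle :: "(nat \<Rightarrow> real) \<Rightarrow> nat \<times> nat set \<Rightarrow> real" where
  "edge_angle \<theta> = (\<lambda>(t, e). \<theta> (3 * t + opposite_pair e))"

definition generalized_angle_structure :: "triangulation \<Rightarrow> (nat \<Rightarrow> real) \<Rightarrow> bool" where
  "generalized_angle_structure \<tau> \<theta> \<longleftrightarrow>
     (\<forall>t<tets \<tau>. \<theta> (3 * t) + \<theta> (3 * t + 1) + \<theta> (3 * t + 2) = pi) \<and>
     (\<forall>E\<in>edges \<tau>. (\<Sum>e\<in>E. edge_angle \<theta> e) = 2 * pi)"

definition positive_angle_structure :: "triangulation \<Rightarrow> (nat \<Rightarrow> real) \<Rightarrow> bool" where
  "positive_angle_structure \<tau> \<theta> \<longleftrightarrow>
     generalized_angle_structure \<tau> \<theta> \<and> (\<forall>j<3 * tets \<tau>. \<theta> j > 0)"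

definition taut_angle_structure :: "triangulation \<Rightarrow> (nat \<Rightarrow> real) \<Rightarrow> bool" where
  "taut_angle_structure \<tau> \<theta> \<longleftrightarrow>
     generalized_angle_structure \<tau> \<theta> \<and> (\<forall>j<3 * tets \<tau>. \<theta> j \<in> {0, pi})"

section \<open>The triangulated boundary, fans and veering\<close>

text \<open>\<open>(t, v, w)\<close> is the following corner: in the boundary triangle that truncates vertex \<open>v\<close> of
  tetrahedron \<open>t\<close>, the corner on the edge from \<open>v\<close> to \<open>w\<close>.\<close>

type_synonym corner = "nat \<times> nat \<times> nat"

definition corners :: "triangulation \<Rightarrow> corner set" where
  "corners \<tau> = {(t, v, w). t < tets \<tau> \<and> v < 4 \<and> w < 4 \<and> v \<noteq> w}"

definition corner_angle :: "(nat \<Rightarrow> real) \<Rightarrow> corner \<Rightarrow> real" where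
  "corner_angle \<theta> = (\<lambda>(t, v, w). edge_angle \<theta> (t, {v, w}))"

definition corner_pairing :: "triangulation \<Rightarrow> corner rel" where
  "corner_pairing \<tau> = {((t, v, w), (nbr \<tau> t f, glue \<tau> t f v, glue \<tau> t f w)) | t v w f.
     (t, v, w) \<in> corners \<tau> \<and> f < 4 \<and> f \<noteq> v \<and> f \<noteq> w}"

definition boundary_vertices :: "triangulation \<Rightarrow> corner set set" where
  "boundary_vertices \<tau> = corners \<tau> // (corner_pairing \<tau>)\<^sup>*"

text \<open>The corners \<open>w\<close>, \<open>x\<close>, \<open>y\<close> of the boundary triangle at \<open>v\<close> are in counterclockwise order iff
  \<open>v, w, x, y\<close> is an even permutation of \<open>0, 1, 2, 3\<close>. Because gluings are odd, this orients the
  boundary triangles coherently.\<close>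

definition ccw :: "nat \<Rightarrow> nat \<Rightarrow> nat \<Rightarrow> nat \<Rightarrow> bool" where
  "ccw v w x y \<longleftrightarrow>
     (let p = (\<lambda>i. if i < 4 then [v, w, x, y] ! i else i) in p permutes {..<4} \<and> evenperm p)"

text \<open>One counterclockwise step around the boundary vertex at which the corner lies: if
  \<open>w\<close>, \<open>x\<close>, \<open>y\<close> are in counterclockwise order, we leave the triangle at \<open>v\<close> through its side
  from \<open>w\<close> to \<open>y\<close>, which lies in face \<open>x\<close>.\<close>

definition rotate_corner :: "triangulation \<Rightarrow> corner \<Rightarrow> corner" where
  "rotate_corner \<tau> = (\<lambda>(t, v, w).
     let x = (THE x. \<exists>y. ccw v w x y) in (nbr \<tau> t x, glue \<tau> t x v, glue \<tau> t x w))"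

text \<open>A fan at the boundary vertex \<open>V\<close> is the (possibly empty) sequence of 0-angled corners strictly
  between two consecutive \<open>\<pi>\<close>-angled corners.\<close>

definition fans :: "triangulation \<Rightarrow> (nat \<Rightarrow> real) \<Rightarrow> corner set \<Rightarrow> corner list set" where
  "fans \<tau> \<alpha> V = {map (\<lambda>i. (rotate_corner \<tau> ^^ i) c) [1..<Suc d] | c d.
     c \<in> V \<and> corner_angle \<alpha> c = pi \<and> corner_angle \<alpha> ((rotate_corner \<tau> ^^ Suc d) c) = pi \<and>
     (\<forall>i\<in>{1..d}. corner_angle \<alpha> ((rotate_corner \<tau> ^^ i) c) = 0)}"

definition max_fan :: "triangulation \<Rightarrow> (nat \<Rightarrow> real) \<Rightarrow> nat" where
  "max_fan \<tau> \<alpha> = Max {length F | F V. V \<in> boundary_vertices \<tau> \<and> F \<in> fans \<tau> \<alpha> V}"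

definition pi_before :: "(nat \<Rightarrow> real) \<Rightarrow> corner \<Rightarrow> bool" where
  "pi_before \<alpha> = (\<lambda>(t, v, w). \<exists>x y. ccw v x w y \<and> corner_angle \<alpha> (t, v, x) = pi)"

definition pi_after :: "(nat \<Rightarrow> real) \<Rightarrow> corner \<Rightarrow> bool" where
  "pi_after \<alpha> = (\<lambda>(t, v, w). \<exists>x y. ccw v w x y \<and> corner_angle \<alpha> (t, v, x) = pi)"

definition veering_angle_structure :: "triangulation \<Rightarrow> (nat \<Rightarrow> real) \<Rightarrow> bool" where
  "veering_angle_structure \<tau> \<alpha> \<longleftrightarrow>
     taut_angle_structure \<tau> \<alpha> \<and>
     (\<forall>V\<in>boundary_vertices \<tau>.
        (\<forall>F\<in>fans \<tau> \<alpha> V. \<forall>c\<in>set F. pi_before \<alpha> c) \<or>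
        (\<forall>F\<in>fans \<tau> \<alpha> V. \<forall>c\<in>set F. pi_after \<alpha> c))"

definition veering_triangulation :: "triangulation \<Rightarrow> (nat \<Rightarrow> real) \<Rightarrow> bool" where
  "veering_triangulation \<tau> \<alpha> \<longleftrightarrow> ideal_triangulation \<tau> \<and> veering_angle_structure \<tau> \<alpha>"

end

theory Submission
  imports Defs
begin

text \<open>
  The positive angle structure is a perturbation of the taut one. Write a corner of a boundary
  triangle as \<open>(v, w, x, y)\<close>: it lies at the tip \<open>v\<close>, on the edge \<open>v w\<close>, and \<open>w, x, y\<close> is
  the counterclockwise order. Give every edge of the triangulation a real weight \<open>X\<close> and add
  \<open>X(v y) + X(w x) - X(v x) - X(w y)\<close> to the angle at \<open>v w\<close>. The three changes in a tetrahedron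
  cancel, and going around an edge the changes telescope (\<open>sum_deformation_orb\<close>). So every choice
  of weights keeps all the equations of an angle structure, and only positivity is at stake.

  Veering colours the edges: red if all \<open>\<pi>\<close>-angles lie immediately before the corners in its fans,
  blue if they lie immediately after. Put \<open>X = x\<close> on red and \<open>X = - x\<close> on blue edges, with \<open>x > 0\<close>.
  In a tetrahedron with \<open>\<pi>\<close>-angles at \<open>v w\<close> and \<open>x y\<close> the edges \<open>v x\<close>, \<open>w y\<close> are red and \<open>v y\<close>,
  \<open>w x\<close> are blue. The \<open>\<pi>\<close>-angle loses the sum of these four weights. The angle
  at the blue pair becomes \<open>x(v x) + x(w y) - X(v w) - X(x y)\<close>, the one at the red pair is the same
  with the colours exchanged. If all \<open>x\<close> lie between \<open>N\<^sup>2\<close> and \<open>2 N\<^sup>2\<close>, a 0-angle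
  can fail to grow only if both \<open>\<pi>\<close>-edges are subtracted, that is, at the blue pair of a tetrahedron
  whose \<open>\<pi>\<close>-edges are both red, or in the mirror image of this situation. There the weights must be
  strictly concave: \<open>x(v x) + x(w y) \<ge> x(v w) + x(x y) + 1\<close>.

  Such tetrahedra fit together like the squares of a grid. The four red edges are the corners of the
  square, \<open>v w\<close> above, \<open>x y\<close> below, \<open>v x\<close> left and \<open>w y\<close> right, and a neighbour across a lower
  face is the next square in its row or column (\<open>down_left_other\<close>, \<open>left_down_other\<close>). Every row
  runs through a fan of a blue edge, so it has at most \<open>N\<close> squares, where \<open>N\<close> is the
  length of the longest fan. The number of rectangles of squares with a given upper corner is then
  at most \<open>N\<^sup>2\<close>, and it satisfies \<open>above + below \<ge> left + right + 1\<close>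
  (\<open>card_boxes_supermodular\<close>). The triangulation need have no global direction "up", so
  all four rectangle counts that start at an edge are averaged and
  subtracted from \<open>2 N\<^sup>2\<close>. This gives the concave weights (\<open>edge_boxes_square\<close>,
  \<open>edge_weights_exist\<close>).

  After scaling by \<open>\<pi> / (12 N\<^sup>2)\<close> a \<open>\<pi>\<close>-angle loses at most \<open>8 N\<^sup>2\<close> units of
  the \<open>12 N\<^sup>2\<close> that it has, and every 0-angle gains at least one unit. Finally an edge has at least
  \<open>N + 3\<close> angles around it if \<open>N\<close> of them form a fan, because there are two \<open>\<pi>\<close>-angles and the
  other fan is not empty (\<open>not_P_rt\<close>).
\<close>

section \<open>Counting rectangles in a partial grid\<close>

text \<open>\<open>(i, j)\<close> stands for the rectangle of \<open>i + 1\<close> rows and \<open>j + 1\<close> columns that has \<open>s\<close> in its corner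
  and extends along \<open>l\<close> and \<open>d\<close>. The predicate \<open>H\<close> singles out the cells that belong to the grid;
  the maps \<open>l\<close> and \<open>d\<close> are total, and their values on other elements mean nothing.\<close>
definition boxes :: "('a \<Rightarrow> bool) \<Rightarrow> ('a \<Rightarrow> 'a) \<Rightarrow> ('a \<Rightarrow> 'a) \<Rightarrow> 'a \<Rightarrow> (nat \<times> nat) set" where
  "boxes H l d s = {(i, j). \<forall>a\<le>j. \<forall>b\<le>i. H ((d ^^ b) ((l ^^ a) s))}"

lemma boxes_empty: "\<not> H s \<Longrightarrow> boxes H l d s = {}"
  by (force simp: boxes_def)

lemma boxes_Suc_right:
  "(i, Suc j) \<in> boxes H l d s \<longleftrightarrow> (i, 0) \<in> boxes H l d s \<and> (i, j) \<in> boxes H l d (l s)"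
proof -
  have "(\<forall>a\<le>Suc j. Q a) \<longleftrightarrow> Q 0 \<and> (\<forall>a\<le>j. Q (Suc a))" for Q
    by (metis Suc_le_mono less_eq_nat.simps(1) not0_implies_Suc)
  then show ?thesis by (simp add: boxes_def funpow_swap1)
qed

lemma boxes_Suc_left_0:
  "(Suc i, 0) \<in> boxes H l d s \<longleftrightarrow> H s \<and> (i, 0) \<in> boxes H l d (d s)"
proof -
  have "(\<forall>a\<le>Suc i. Q a) \<longleftrightarrow> Q 0 \<and> (\<forall>a\<le>i. Q (Suc a))" for Q
    by (metis Suc_le_mono less_eq_nat.simps(1) not0_implies_Suc)
  then show ?thesis by (simp add: boxes_def funpow_swap1)
qed

lemma boxes_0_0: "(0, 0) \<in> boxes H l d s \<longleftrightarrow> H s"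
  by (simp add: boxes_def)

text \<open>Removing the first row. The two steps commute only where the three cells \<open>s\<close>, \<open>l s\<close>, \<open>d s\<close> exist,
  so the commutation is carried along the first row one cell at a time.\<close>
lemma boxes_shift:
  assumes comm: "\<And>s. H s \<Longrightarrow> H (l s) \<Longrightarrow> H (d s) \<Longrightarrow> l (d s) = d (l s)"
    and box: "(Suc i, j) \<in> boxes H l d s"
  shows "(i, j) \<in> boxes H l d (d s)"
proof -
  have H: "H ((d ^^ b) ((l ^^ a) s))" if "a \<le> j" "b \<le> Suc i" for a b
    using box that by (simp add: boxes_def)
  have swap: "(l ^^ a) (d s) = d ((l ^^ a) s)" if "a \<le> j" for a
    using that
  proof (induction a)
    case (Suc a)
    have "H ((l ^^ a) s)" "H (l ((l ^^ a) s))" "H (d ((l ^^ a) s))"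
      using H[of a 0] H[of "Suc a" 0] H[of a 1] Suc.prems by simp_all
    from comm[OF this] Suc show ?case by simp
  qed simp
  show ?thesis
    unfolding boxes_def
  proof (clarify)
    fix a b assume "a \<le> j" "b \<le> i"
    then show "H ((d ^^ b) ((l ^^ a) (d s)))"
      using swap[of a] H[of a "Suc b"] by (simp add: funpow_swap1)
  qed
qed

lemma card_nat_pairs_split_fst:
  assumes "finite (A :: (nat \<times> nat) set)"
  shows "card A = card {j. (0, j) \<in> A} + card {(i, j). (Suc i, j) \<in> A}"
proof -
  have A: "A = Pair (0::nat) ` {j. (0, j) \<in> A} \<union> map_prod Suc id ` {(i, j). (Suc i, j) \<in> A}"
  proof (intro equalityI subsetI)
    fix p assume "p \<in> A"
    then show "p \<in> Pair (0::nat) ` {j. (0, j) \<in> A} \<union> map_prod Suc id ` {(i, j). (Suc i, j) \<in> A}"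
      by (cases p; cases "fst p") (auto simp: image_iff)
  qed auto
  have "Pair (0::nat) ` {j. (0, j) \<in> A} \<subseteq> A" "map_prod Suc id ` {(i, j). (Suc i, j) \<in> A} \<subseteq> A"
    by auto
  note sub = this
  have "card (Pair (0::nat) ` {j. (0, j) \<in> A} \<union> map_prod Suc id ` {(i, j). (Suc i, j) \<in> A})
      = card (Pair (0::nat) ` {j. (0, j) \<in> A}) + card (map_prod Suc id ` {(i, j). (Suc i, j) \<in> A})"
    by (rule card_Un_disjoint[OF sub[THEN finite_subset, OF assms]]) auto
  then have "card A = card (Pair (0::nat) ` {j. (0, j) \<in> A}) + card (map_prod Suc id ` {(i, j). (Suc i, j) \<in> A})"
    unfolding A[symmetric] .
  also have "\<dots> = card {j. (0, j) \<in> A} + card {(i, j). (Suc i, j) \<in> A}"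
    by (simp add: card_image inj_on_def map_prod_def split_beta prod_eq_iff)
  finally show ?thesis .
qed

lemma card_nat_pairs_split_snd:
  assumes "finite (A :: (nat \<times> nat) set)"
  shows "card A = card {i. (i, 0) \<in> A} + card {(i, j). (i, Suc j) \<in> A}"
proof -
  have "card A = card (prod.swap ` A)" by (simp add: card_image)
  also have "\<dots> = card {j. (0, j) \<in> prod.swap ` A} + card {(i, j). (Suc i, j) \<in> prod.swap ` A}"
    by (rule card_nat_pairs_split_fst) (simp add: assms)
  also have "{j. (0, j) \<in> prod.swap ` A} = {i. (i, 0) \<in> A}" by force
  also have "{(i, j). (Suc i, j) \<in> prod.swap ` A} = prod.swap ` {(i, j). (i, Suc j) \<in> A}"
    by force
  also have "card \<dots> = card {(i, j). (i, Suc j) \<in> A}" by (simp add: card_image)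
  finally show ?thesis .
qed

lemma finite_shifted_pairs:
  assumes "finite A" shows "finite {(i, j). (Suc i, j) \<in> A}" "finite {(i, j). (i, Suc j) \<in> A}"
proof -
  have "{(i, j). (Suc i, j) \<in> A} = map_prod Suc id -` A" "{(i, j). (i, Suc j) \<in> A} = map_prod id Suc -` A"
    by auto
  then show "finite {(i, j). (Suc i, j) \<in> A}" "finite {(i, j). (i, Suc j) \<in> A}"
    using assms by (auto intro!: finite_vimageI prod.inj_map)
qed

text \<open>Identify a rectangle with its extreme cell. Apart from the rectangles in the row and the column of
  \<open>s\<close> itself, those starting at \<open>l s\<close> and those starting at \<open>d s\<close> give two sets \<open>X\<close>, \<open>Y\<close> of rectangles
  starting at the diagonal neighbour \<open>\<beta>\<close>, and a rectangle in both sets extends to one that starts at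
  \<open>s\<close>. Now use \<open>|X| + |Y| = |X \<union> Y| + |X \<inter> Y|\<close>; the additional 1 is the cell \<open>s\<close>.
  If neither neighbour belongs to the grid, \<open>\<beta>\<close> is arbitrary.\<close>
lemma card_boxes_supermodular:
  assumes comm: "\<And>s. H s \<Longrightarrow> H (l s) \<Longrightarrow> H (d s) \<Longrightarrow> l (d s) = d (l s)"
    and fin: "\<And>s. finite (boxes H l d s)"
    and H: "H s"
    and \<beta>: "H (l s) \<Longrightarrow> d (l s) = \<beta>" "H (d s) \<Longrightarrow> l (d s) = \<beta>"
  shows "card (boxes H l d (l s)) + card (boxes H l d (d s)) + 1
       \<le> card (boxes H l d s) + card (boxes H l d \<beta>)"
proof -
  let ?B = "boxes H l d"
  define X where "X = {(i, j). (Suc i, j) \<in> ?B (l s)}"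
  define Y where "Y = {(i, j). (i, Suc j) \<in> ?B (d s)}"
  define C where "C = {(i, j). (Suc i, j) \<in> ?B s}"
  have fins: "finite X" "finite Y" "finite C" "finite {(i, j). (i, Suc j) \<in> C}"
    unfolding X_def Y_def C_def by (intro finite_shifted_pairs fin)+
  have X: "X \<subseteq> ?B \<beta>"
  proof (cases "H (l s)")
    case True
    then show ?thesis
      using boxes_shift[of H l d, OF comm] \<beta>(1) by (auto simp: X_def)
  qed (simp add: X_def boxes_empty)
  have Y: "Y \<subseteq> ?B \<beta>"
  proof (cases "H (d s)")
    case True
    then show ?thesis using \<beta>(2) by (auto simp: Y_def boxes_Suc_right)
  qed (simp add: Y_def boxes_empty)
  have XY: "X \<inter> Y \<subseteq> {(i, j). (i, Suc j) \<in> C}"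
    using H by (auto simp: X_def Y_def C_def boxes_Suc_right boxes_Suc_left_0)
  have "{i. (i, 0) \<in> ?B (d s)} = {i. (i, 0) \<in> C}"
    using H by (simp add: C_def boxes_Suc_left_0)
  then have card_d: "card (?B (d s)) = card {i. (i, 0) \<in> C} + card Y"
    using card_nat_pairs_split_snd[OF fin, of "d s"] by (simp add: Y_def)
  have card_C: "card C = card {i. (i, 0) \<in> C} + card {(i, j). (i, Suc j) \<in> C}"
    by (rule card_nat_pairs_split_snd) (rule fins)
  have "{j. (0, j) \<in> ?B s} = insert 0 (Suc ` {j. (0, j) \<in> ?B (l s)})"
  proof (intro set_eqI)
    fix j show "j \<in> {j. (0, j) \<in> ?B s} \<longleftrightarrow> j \<in> insert 0 (Suc ` {j. (0, j) \<in> ?B (l s)})"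
      using H by (cases j) (auto simp: boxes_Suc_right boxes_0_0)
  qed
  moreover have "finite {j. (0, j) \<in> ?B (l s)}"
    using finite_vimageI[OF fin[of "l s"], of "Pair (0::nat)"] by (simp add: vimage_def inj_on_def)
  ultimately have row: "card {j. (0, j) \<in> ?B s} = card {j. (0, j) \<in> ?B (l s)} + 1"
    by (simp add: card_image)
  have "card X + card Y = card (X \<union> Y) + card (X \<inter> Y)"
    using fins by (intro card_Un_Int)
  also have "\<dots> \<le> card (?B \<beta>) + card {(i, j). (i, Suc j) \<in> C}"
    using X Y XY fins fin by (intro add_mono card_mono) auto
  finally have "card X + card Y \<le> card (?B \<beta>) + card {(i, j). (i, Suc j) \<in> C}" .
  then show ?thesis
    using card_nat_pairs_split_fst[OF fin, of s] card_nat_pairs_split_fst[OF fin, of "l s"]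
      row card_d card_C by (simp add: X_def C_def)
qed

section \<open>Flags with a turn, a flip and a crossing\<close>

text \<open>The orbit under a map and its inverse. Listing both makes the definition symmetric, so that exchanging
  the two maps gives the same set.\<close>
definition orb :: "('a \<Rightarrow> 'a) \<Rightarrow> ('a \<Rightarrow> 'a) \<Rightarrow> 'a \<Rightarrow> 'a set" where
  "orb f g c = {(f ^^ n) c | n. True} \<union> {(g ^^ n) c | n. True}"

text \<open>The combinatorics of an oriented triangulation, as seen from its flags \<open>(v, w, x, y)\<close>, the even
  orderings of the vertices of a tetrahedron. \<open>nx\<close> turns to \<open>(v, x, y, w)\<close>, the next corner of the
  boundary triangle at \<open>v\<close>; \<open>rv\<close> reverses the edge to \<open>(w, v, y, x)\<close>; \<open>rt\<close> crosses the face
  opposite to \<open>x\<close> and \<open>ri\<close> the face opposite to \<open>y\<close>, both rotating around the edge \<open>v w\<close>. Working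
  with these maps alone makes the mirror image an instance of the same locale: replace \<open>nx\<close> by its
  square and exchange \<open>rt\<close> with \<open>ri\<close>. The last assumption says that no face is glued to itself.\<close>
locale oriented_flags =
  fixes K :: "'a set" and nx rv rt ri :: "'a \<Rightarrow> 'a"
  assumes fin: "finite K"
    and closed: "\<And>c. c \<in> K \<Longrightarrow> nx c \<in> K" "\<And>c. c \<in> K \<Longrightarrow> rv c \<in> K"
      "\<And>c. c \<in> K \<Longrightarrow> rt c \<in> K" "\<And>c. c \<in> K \<Longrightarrow> ri c \<in> K"
    and nx3: "\<And>c. c \<in> K \<Longrightarrow> nx (nx (nx c)) = c"
    and rv2: "\<And>c. c \<in> K \<Longrightarrow> rv (rv c) = c"
    and rv_nx_rv: "\<And>c. c \<in> K \<Longrightarrow> rv (nx (rv c)) = nx (nx (rv (nx (nx c))))"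
    and ri_rt: "\<And>c. c \<in> K \<Longrightarrow> ri (rt c) = c"
    and rt_ri: "\<And>c. c \<in> K \<Longrightarrow> rt (ri c) = c"
    and rt_rv: "\<And>c. c \<in> K \<Longrightarrow> rt (rv c) = rv (ri c)"
    and rt_nx_rt: "\<And>c. c \<in> K \<Longrightarrow> rt (nx (rt c)) = nx (nx c)"
    and rv_neq: "\<And>c. c \<in> K \<Longrightarrow> rv c \<noteq> c"
    and rt_neq_rv: "\<And>c. c \<in> K \<Longrightarrow> rt c \<noteq> rv c"
begin

text \<open>\<open>(x, y, v, w)\<close>, on the opposite edge.\<close>
abbreviation opp :: "'a \<Rightarrow> 'a" where "opp c \<equiv> nx (nx (rv (nx c)))"

lemma ri_rv: "c \<in> K \<Longrightarrow> ri (rv c) = rv (rt c)"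
  using rt_rv[of "rt c"] by (metis closed(2,3) ri_rt)

lemma nx_rt: "c \<in> K \<Longrightarrow> nx (rt c) = ri (nx (nx c))"
  by (metis closed(1,3) ri_rt rt_nx_rt)

lemma nx_nx_ri: "c \<in> K \<Longrightarrow> nx (nx (ri c)) = rt (nx c)"
  by (metis closed(4) rt_ri rt_nx_rt)

lemma nx_rv_nx_nx: "c \<in> K \<Longrightarrow> nx (rv (nx (nx c))) = rv (opp c)"
  by (metis closed(1,2) nx3 rv2 rv_nx_rv)

lemma nx_rv_nx: "c \<in> K \<Longrightarrow> nx (rv (nx c)) = rv (nx (nx (rv c)))"
  using nx_rv_nx_nx[of "nx (nx c)"] by (simp add: closed nx3)

lemma opp_rv: "c \<in> K \<Longrightarrow> opp (rv c) = rv (opp c)"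
  by (metis closed(1,2) nx3 rv2 rv_nx_rv)

lemma opp_opp: "c \<in> K \<Longrightarrow> opp (opp c) = c"
  by (metis closed(1,2) nx3 rv2)

lemma closed_pow: "c \<in> K \<Longrightarrow> (rt ^^ n) c \<in> K" "c \<in> K \<Longrightarrow> (ri ^^ n) c \<in> K"
  by (induction n) (auto simp: closed)

lemma ri_pow_rt_pow: "c \<in> K \<Longrightarrow> (ri ^^ n) ((rt ^^ n) c) = c"
proof (induction n)
  case (Suc n)
  have "(ri ^^ Suc n) ((rt ^^ Suc n) c) = (ri ^^ n) (ri (rt ((rt ^^ n) c)))"
    by (simp add: funpow_swap1)
  with Suc show ?case by (simp add: ri_rt closed_pow)
qed simp

lemma rt_pow_ri_pow: "c \<in> K \<Longrightarrow> (rt ^^ n) ((ri ^^ n) c) = c"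
proof (induction n)
  case (Suc n)
  have "(rt ^^ Suc n) ((ri ^^ Suc n) c) = (rt ^^ n) (rt (ri ((ri ^^ n) c)))"
    by (simp add: funpow_swap1)
  with Suc show ?case by (simp add: rt_ri closed_pow)
qed simp

lemma orb_subset: "c \<in> K \<Longrightarrow> orb rt ri c \<subseteq> K"
  by (auto simp: orb_def closed_pow)

lemma orb_self: "c \<in> orb rt ri c"
  by (auto simp: orb_def intro: exI[of _ 0])

lemma orb_rt: assumes "c \<in> K" "c' \<in> orb rt ri c" shows "rt c' \<in> orb rt ri c"
proof -
  consider n where "c' = (rt ^^ n) c" | n where "c' = (ri ^^ n) c"
    using assms(2) unfolding orb_def by blast
  then show ?thesis
  proof cases
    case 1
    then have "rt c' = (rt ^^ Suc n) c" by simp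
    then show ?thesis unfolding orb_def by blast
  next
    case 2
    show ?thesis
    proof (cases n)
      case 0
      then have "rt c' = (rt ^^ Suc 0) c" using 2 by simp
      then show ?thesis unfolding orb_def by blast
    next
      case (Suc m)
      then have "rt c' = (ri ^^ m) c" using 2 assms(1) by (simp add: rt_ri closed_pow)
      then show ?thesis unfolding orb_def by blast
    qed
  qed
qed

lemma orb_ri: assumes "c \<in> K" "c' \<in> orb rt ri c" shows "ri c' \<in> orb rt ri c"
proof -
  consider n where "c' = (ri ^^ n) c" | n where "c' = (rt ^^ n) c"
    using assms(2) unfolding orb_def by blast
  then show ?thesis
  proof cases
    case 1
    then have "ri c' = (ri ^^ Suc n) c" by simp
    then show ?thesis unfolding orb_def by blast
  next
    case 2
    show ?thesis
    proof (cases n)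
      case 0
      then have "ri c' = (ri ^^ Suc 0) c" using 2 by simp
      then show ?thesis unfolding orb_def by blast
    next
      case (Suc m)
      then have "ri c' = (rt ^^ m) c" using 2 assms(1) by (simp add: ri_rt closed_pow)
      then show ?thesis unfolding orb_def by blast
    qed
  qed
qed

lemma orb_minimal:
  assumes "c \<in> A" "\<And>z. z \<in> A \<Longrightarrow> rt z \<in> A" "\<And>z. z \<in> A \<Longrightarrow> ri z \<in> A"
  shows "orb rt ri c \<subseteq> A"
proof -
  have "(rt ^^ n) c \<in> A" "(ri ^^ n) c \<in> A" for n
    by (induction n) (auto simp: assms)
  then show ?thesis by (auto simp: orb_def)
qed

lemma orb_sym: assumes "c \<in> K" "c' \<in> orb rt ri c" shows "c \<in> orb rt ri c'"
proof -
  obtain n where "c' = (rt ^^ n) c \<or> c' = (ri ^^ n) c"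
    using assms(2) unfolding orb_def by blast
  then have "c = (ri ^^ n) c' \<or> c = (rt ^^ n) c'"
    using assms(1) ri_pow_rt_pow rt_pow_ri_pow by auto
  then show ?thesis unfolding orb_def by blast
qed

lemma orb_eq: assumes "c \<in> K" "c' \<in> orb rt ri c" shows "orb rt ri c' = orb rt ri c"
proof -
  have c': "c' \<in> K" using assms orb_subset by auto
  show ?thesis
  proof (rule subset_antisym)
    show "orb rt ri c' \<subseteq> orb rt ri c"
      by (rule orb_minimal) (use assms orb_rt orb_ri in auto)
    show "orb rt ri c \<subseteq> orb rt ri c'"
      by (rule orb_minimal) (use assms c' orb_rt orb_ri orb_sym in auto)
  qed
qed

lemma orb_rv: assumes "c \<in> K" shows "orb rt ri (rv c) = rv ` orb rt ri c"
proof -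
  have "rv ` orb rt ri z \<supseteq> orb rt ri (rv z)" if z: "z \<in> K" for z
  proof (rule orb_minimal)
    show "rv z \<in> rv ` orb rt ri z" by (simp add: orb_self)
    fix y assume "y \<in> rv ` orb rt ri z"
    then obtain u where u: "u \<in> orb rt ri z" "y = rv u" "u \<in> K" using orb_subset[OF z] by auto
    then show "rt y \<in> rv ` orb rt ri z" "ri y \<in> rv ` orb rt ri z"
      using orb_rt[OF z] orb_ri[OF z] by (auto simp: rt_rv ri_rv)
  qed
  moreover from this[of "rv c"] have "rv ` orb rt ri c \<subseteq> rv ` rv ` orb rt ri (rv c)"
    using assms by (simp add: closed rv2 image_mono)
  moreover have "rv ` rv ` A = A" if "A \<subseteq> K" for A
    using that by (force simp: image_iff rv2 subset_iff)
  ultimately show ?thesis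
    using assms orb_subset[of "rv c"] by (metis closed(2) subset_antisym)
qed

lemma finite_orb: "c \<in> K \<Longrightarrow> finite (orb rt ri c)"
  using orb_subset fin finite_subset by blast

lemma orb_two: assumes "c \<in> K" "rt (rt c) = c" shows "orb rt ri c = {c, rt c}"
proof
  have "ri c = rt c" using assms ri_rt[of "rt c"] by (simp add: closed)
  then show "orb rt ri c \<subseteq> {c, rt c}" by (intro orb_minimal) (use assms in \<open>auto simp: ri_rt\<close>)
  show "{c, rt c} \<subseteq> orb rt ri c" using orb_self orb_rt[OF assms(1)] by auto
qed

lemma rt_pow_inj: assumes "c \<in> K" "c' \<in> K" "(rt ^^ m) c = (rt ^^ m) c'" shows "c = c'"
proof -
  have "(ri ^^ m) ((rt ^^ m) c) = (ri ^^ m) ((rt ^^ m) c')" using assms(3) by (rule arg_cong)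
  then show ?thesis unfolding ri_pow_rt_pow[OF assms(1)] ri_pow_rt_pow[OF assms(2)] .
qed

lemma rt_pow_diff: assumes "c \<in> K" "(rt ^^ i) c = (rt ^^ j) c" "i \<le> j" shows "(rt ^^ (j - i)) c = c"
proof (rule rt_pow_inj[of _ _ i])
  show "(rt ^^ i) ((rt ^^ (j - i)) c) = (rt ^^ i) c"
    using assms(2,3) by (simp flip: funpow_add[THEN fun_cong, unfolded comp_apply])
qed (use assms(1) closed_pow in auto)

lemma rt_pow_period: assumes "c \<in> K" obtains n where "0 < n" "(rt ^^ n) c = c"
proof -
  have "\<exists>i j. i < j \<and> (rt ^^ i) c = (rt ^^ j) c"
  proof (rule ccontr)
    assume "\<not> ?thesis"
    then have "inj_on (\<lambda>n. (rt ^^ n) c) {..card K}"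
      by (intro linorder_inj_onI) auto
    then have "card {..card K} \<le> card K"
      by (rule card_inj_on_le) (use assms fin closed_pow in auto)
    then show False by simp
  qed
  then obtain i j where "i < j" "(rt ^^ i) c = (rt ^^ j) c" by blast
  then show ?thesis using that[of "j - i"] rt_pow_diff[OF assms, of i j] by simp
qed

lemma orb_eq_rt_pow: assumes "c \<in> K" shows "orb rt ri c = range (\<lambda>n. (rt ^^ n) c)"
proof
  obtain p where p: "0 < p" "(rt ^^ p) c = c" using rt_pow_period[OF assms] .
  show "orb rt ri c \<subseteq> range (\<lambda>n. (rt ^^ n) c)"
  proof (rule orb_minimal)
    show "c \<in> range (\<lambda>n. (rt ^^ n) c)" by (rule range_eqI[of _ _ 0]) simp
    fix z assume "z \<in> range (\<lambda>n. (rt ^^ n) c)"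
    then obtain n where n: "z = (rt ^^ n) c" by auto
    then have "rt z = (rt ^^ Suc n) c" by simp
    then show "rt z \<in> range (\<lambda>n. (rt ^^ n) c)" by blast
    obtain q where q: "p = Suc q" using p(1) by (cases p) auto
    have "z = (rt ^^ (n + p)) c" using n p(2) by (simp add: funpow_add)
    then have "z = rt ((rt ^^ (n + q)) c)" by (simp add: q)
    then have "ri z = (rt ^^ (n + q)) c" using assms by (simp add: ri_rt closed_pow)
    then show "ri z \<in> range (\<lambda>n. (rt ^^ n) c)" by blast
  qed
qed (auto simp: orb_def)

lemma bij_rt_orb: assumes "c \<in> K" shows "bij_betw rt (orb rt ri c) (orb rt ri c)"
proof (rule bij_betw_byWitness[of _ ri])
  show "\<forall>a\<in>orb rt ri c. ri (rt a) = a" "\<forall>a\<in>orb rt ri c. rt (ri a) = a"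
    using orb_subset[OF assms] by (auto simp: ri_rt rt_ri)
qed (use orb_rt[OF assms] orb_ri[OF assms] in auto)

lemma rt_pow_rv: "c \<in> K \<Longrightarrow> (rt ^^ n) (rv c) = rv ((ri ^^ n) c)"
  by (induction n) (auto simp: rt_rv closed_pow)

lemma ri_neq_rv: "c \<in> K \<Longrightarrow> ri c \<noteq> rv c"
  using rt_neq_rv[of "rv c"] by (auto simp: closed rv2 rt_rv)

text \<open>No edge is identified with its own reverse. Since \<open>rv\<close> inverts the rotation, a rotation taking \<open>c\<close>
  to \<open>rv c\<close> has a midpoint: either a flag equal to its reverse, or a face through which a flag
  passes to its own reverse.\<close>
lemma rv_notin_orb: assumes "c \<in> K" shows "rv c \<notin> orb rt ri c"
proof
  assume "rv c \<in> orb rt ri c"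
  then obtain k where k: "rv c = (rt ^^ k) c" using orb_eq_rt_pow[OF assms] by auto
  have "k = k div 2 + (k mod 2 + k div 2) \<and> (k mod 2 = 0 \<or> k mod 2 = 1)" by presburger
  then obtain m r where m: "k = m + (r + m)" "r = 0 \<or> r = 1" ..
  let ?d = "(rt ^^ m) c"
  have d: "?d \<in> K" using assms by (simp add: closed_pow)
  have "(rt ^^ m) (rv ?d) = rv c" using rt_pow_rv[OF d] by (simp add: ri_pow_rt_pow assms)
  also have "\<dots> = (rt ^^ m) ((rt ^^ r) ?d)" unfolding k m(1) by (simp add: funpow_add)
  finally have eq: "rv ?d = (rt ^^ r) ?d"
    by (rule rt_pow_inj[rotated 2]) (use d in \<open>auto simp: closed closed_pow\<close>)
  from m(2) show False
  proof
    assume "r = 0"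
    then show False using eq rv_neq[OF d] by simp
  next
    assume "r = 1"
    then show False using eq rt_neq_rv[OF d] by simp
  qed
qed

end

section \<open>Taut structures and fans\<close>

text \<open>\<open>P\<close> marks the flags whose angle is \<open>\<pi>\<close>.\<close>
locale taut_flags = oriented_flags +
  fixes P :: "'a \<Rightarrow> bool"
  assumes P_rv: "\<And>c. c \<in> K \<Longrightarrow> P (rv c) = P c"
    and P_opp: "\<And>c. c \<in> K \<Longrightarrow> P (nx (nx (rv (nx c)))) = P c"
    and P_some: "\<And>c. c \<in> K \<Longrightarrow> P c \<or> P (nx c) \<or> P (nx (nx c))"
    and P_unique: "\<And>c. c \<in> K \<Longrightarrow> P c \<Longrightarrow> \<not> P (nx c)"
    and two_pi: "\<And>c. c \<in> K \<Longrightarrow> card {c' \<in> orb rt ri c. P c'} = 2"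
begin

lemma P_nx_nx: "c \<in> K \<Longrightarrow> P c \<Longrightarrow> \<not> P (nx (nx c))"
  using P_unique[of "nx (nx c)"] by (auto simp: closed nx3)

lemma pi_flags_eq:
  assumes "c \<in> K" "a \<in> orb rt ri c" "b \<in> orb rt ri c" "P a" "P b" "a \<noteq> b"
  shows "{c' \<in> orb rt ri c. P c'} = {a, b}"
  using card_subset_eq[of "{c' \<in> orb rt ri c. P c'}" "{a, b}"] assms two_pi[of c] finite_orb[of c] by auto

text \<open>Every run of 0-angles around an edge is part of a fan: follow it in both directions up to
  the first \<open>\<pi>\<close>-angle.\<close>
lemma zero_run_in_fan:
  assumes "c \<in> K" and zero: "\<And>a. a \<le> k \<Longrightarrow> \<not> P ((rt ^^ a) c)"
  obtains c0 d n where "c0 \<in> orb rt ri c" "k < d" "P c0" "P ((rt ^^ Suc d) c0)"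
    "\<And>i. 1 \<le> i \<Longrightarrow> i \<le> d \<Longrightarrow> \<not> P ((rt ^^ i) c0)" "1 \<le> n" "n \<le> d" "(rt ^^ n) c0 = c"
proof -
  have "{c' \<in> orb rt ri c. P c'} \<noteq> {}" using two_pi[OF assms(1)] by fastforce
  then obtain z where z: "z \<in> orb rt ri c" "P z" "z \<in> K" using orb_subset[OF assms(1)] by auto
  obtain u where "(rt ^^ u) c = z" using z orb_eq_rt_pow[OF assms(1)] by auto
  then have "\<exists>u. P ((rt ^^ u) c)" using z by auto
  define m where "m = (LEAST u. P ((rt ^^ u) c))"
  have m: "P ((rt ^^ m) c)" "\<And>i. i < m \<Longrightarrow> \<not> P ((rt ^^ i) c)"
    using LeastI_ex[OF \<open>\<exists>u. P ((rt ^^ u) c)\<close>] not_less_Least by (auto simp: m_def)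
  have km: "k < m" using zero[of m] m(1) by (meson not_less)
  have "c \<in> orb rt ri z" using z orb_sym[OF assms(1)] by auto
  then obtain u where "(rt ^^ u) z = c" using orb_eq_rt_pow[OF z(3)] by auto
  then have "(ri ^^ u) c = z" using ri_pow_rt_pow[OF z(3)] by auto
  then have "\<exists>u. P ((ri ^^ u) c)" using z by auto
  define n where "n = (LEAST u. P ((ri ^^ u) c))"
  have n: "P ((ri ^^ n) c)" "\<And>i. i < n \<Longrightarrow> \<not> P ((ri ^^ i) c)"
    using LeastI_ex[OF \<open>\<exists>u. P ((ri ^^ u) c)\<close>] not_less_Least by (auto simp: n_def)
  have n0: "1 \<le> n" using zero[of 0] n(1) by (cases n) auto
  let ?c0 = "(ri ^^ n) c"
  have lo: "(rt ^^ i) ?c0 = (ri ^^ (n - i)) c" if "i \<le> n" for i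
  proof -
    have "?c0 = (ri ^^ i) ((ri ^^ (n - i)) c)" using that funpow_add[of i "n - i" ri] by simp
    then show ?thesis using assms(1) by (simp add: rt_pow_ri_pow closed_pow)
  qed
  have hi: "(rt ^^ (i + n)) ?c0 = (rt ^^ i) c" for i
    using assms(1) by (simp add: funpow_add rt_pow_ri_pow)
  show ?thesis
  proof (rule that[of ?c0 "n + m - 1" n])
    show "?c0 \<in> orb rt ri c" unfolding orb_def by blast
    show "k < n + m - 1" "n \<le> n + m - 1" using n0 km by auto
    show "P ((rt ^^ Suc (n + m - 1)) ?c0)" using hi[of m] m(1) n0 by (simp add: add.commute)
    fix i assume i: "1 \<le> i" "i \<le> n + m - 1"
    show "\<not> P ((rt ^^ i) ?c0)"
    proof (cases "i \<le> n")
      case True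
      then show ?thesis using lo[of i] n(2)[of "n - i"] i by auto
    next
      case False
      then show ?thesis using hi[of "i - n"] m(2)[of "i - n"] i by auto
    qed
  qed (use n n0 lo[of n] in auto)
qed

end

text \<open>\<open>red\<close> is the colour of an edge. Red edges have the \<open>\<pi>\<close>-angle immediately before each of their
  0-angled corners, blue edges immediately after.\<close>
locale veering_flags = taut_flags +
  fixes red :: "'a \<Rightarrow> bool"
  assumes red_rt: "\<And>c. c \<in> K \<Longrightarrow> red (rt c) = red c"
    and red_rv: "\<And>c. c \<in> K \<Longrightarrow> red (rv c) = red c"
    and red_zero: "\<And>c. c \<in> K \<Longrightarrow> \<not> P c \<Longrightarrow> red c = P (nx (nx c))"
begin

lemma red_orb: assumes "c \<in> K" "c' \<in> orb rt ri c" shows "red c' = red c"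
proof -
  have "orb rt ri c \<subseteq> {z \<in> K. red z = red c}"
    by (rule orb_minimal) (use assms in \<open>auto simp: closed red_rt, (metis closed(4) red_rt rt_ri)+\<close>)
  then show ?thesis using assms by auto
qed

text \<open>No fan is empty. If two neighbouring triangles have their \<open>\<pi>\<close>-angles at the same vertex, consider the
  other end of the side that they share: there both have 0-angles, next to each other in the same
  fan, but one has its \<open>\<pi>\<close>-angle before and the other one after this corner.\<close>
lemma not_P_rt: assumes "c \<in> K" "P c" shows "\<not> P (rt c)"
proof
  assume Prt: "P (rt c)"
  let ?d = "nx (rt c)"
  have K: "?d \<in> K" "rt c \<in> K" by (auto simp: assms closed)
  have "red (rt ?d) = P (nx (nx (rt ?d)))"
    using assms P_nx_nx by (intro red_zero) (auto simp: closed rt_nx_rt)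
  moreover have "red ?d = P (nx (nx ?d))"
    using P_unique[OF K(2) Prt] K by (intro red_zero) auto
  ultimately show False
    using assms P_unique[OF assms] Prt K red_rt[OF K(1)] by (simp add: rt_nx_rt closed nx3)
qed

lemma not_P_ri: "c \<in> K \<Longrightarrow> P c \<Longrightarrow> \<not> P (ri c)"
  using not_P_rt[of "ri c"] by (auto simp: closed rt_ri)

lemma rt_rt_neq: assumes "c \<in> K" shows "rt (rt c) \<noteq> c"
proof
  assume eq: "rt (rt c) = c"
  have "\<not> (P c \<and> P (rt c))" using not_P_rt assms by blast
  then have "{c' \<in> orb rt ri c. P c'} \<subseteq> {c} \<or> {c' \<in> orb rt ri c. P c'} \<subseteq> {rt c}"
    unfolding orb_two[OF assms eq] by auto
  then have "card {c' \<in> orb rt ri c. P c'} \<le> 1"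
    by (metis card.empty card.insert card_mono empty_iff finite.emptyI finite.insertI One_nat_def)
  then show False using two_pi[OF assms] by simp
qed

lemma rt_neq_ri: "c \<in> K \<Longrightarrow> rt c \<noteq> ri c"
  using rt_rt_neq[of "ri c"] by (metis closed(4) rt_ri)

text \<open>The \<open>d\<close> corners of the fan, its two bounding \<open>\<pi>\<close>-angles and the corner just before
  the first of these are all different.\<close>
lemma fan_length_le_degree:
  assumes c: "c \<in> K" "P c" "P ((rt ^^ Suc d) c)"
    and zero: "\<And>i. 1 \<le> i \<Longrightarrow> i \<le> d \<Longrightarrow> \<not> P ((rt ^^ i) c)"
  shows "d + 3 \<le> card (orb rt ri c)"
proof -
  have no_return: "(rt ^^ p) c \<noteq> c" if "1 \<le> p" "p \<le> Suc d" for p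
  proof
    assume eq: "(rt ^^ p) c = c"
    then have p: "p = Suc d" using zero[of p] that c by (cases "p = Suc d") auto
    have "c' = c" if c': "c' \<in> orb rt ri c" "P c'" for c'
    proof -
      obtain n where n: "c' = (rt ^^ n) c" using c' orb_eq_rt_pow[OF c(1)] by auto
      have "c' = (rt ^^ (n mod p)) c" unfolding n using funpow_mod_eq[OF eq] by simp
      then show ?thesis using zero[of "n mod p"] c'(2) p mod_less_divisor[of p n]
        by (cases "n mod p = 0") (auto simp del: mod_less_divisor)
    qed
    then have "{c' \<in> orb rt ri c. P c'} \<subseteq> {c}" by auto
    then have "card {c' \<in> orb rt ri c. P c'} \<le> card {c}" by (rule card_mono[rotated]) simp
    then show False using two_pi[OF c(1)] by simp
  qed
  let ?z = "ri c"
  have z: "?z \<in> K" using c by (simp add: closed)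
  have Suc: "(rt ^^ Suc i) ?z = (rt ^^ i) c" for i
    using c by (simp add: funpow_swap1 rt_ri)
  have "inj_on (\<lambda>i. (rt ^^ i) ?z) {..d + 2}"
  proof (rule linorder_inj_onI)
    fix i j :: nat assume ij: "i < j" "i \<in> {..d + 2}" "j \<in> {..d + 2}"
    show "(rt ^^ i) ?z \<noteq> (rt ^^ j) ?z"
    proof
      assume "(rt ^^ i) ?z = (rt ^^ j) ?z"
      then have ret: "(rt ^^ (j - i)) ?z = ?z" using rt_pow_diff[OF z, of i j] ij by simp
      then have "rt ((rt ^^ (j - i)) ?z) = c" using c by (simp add: rt_ri)
      then have "(rt ^^ (j - i)) c = c" using Suc[of "j - i"] by simp
      then have "j - i = d + 2" using no_return[of "j - i"] ij by (cases "j - i \<le> Suc d") auto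
      then have "(rt ^^ Suc d) c = ?z" using ret Suc[of "Suc d"] by simp
      then show False using c not_P_ri[OF c(1,2)] by simp
    qed
  qed auto
  moreover have "(\<lambda>i. (rt ^^ i) ?z) ` {..d + 2} \<subseteq> orb rt ri c"
    using orb_eq_rt_pow[OF z] orb_eq[OF c(1) orb_ri[OF c(1) orb_self]] by auto
  ultimately have "card {..d + 2} \<le> card (orb rt ri c)"
    using finite_orb[OF c(1)] by (metis card_inj_on_le)
  then show ?thesis by simp
qed

section \<open>The grid of monochromatic tetrahedra\<close>

definition other :: "'a \<Rightarrow> 'a" where
  "other c = (SOME c'. c' \<in> orb rt ri c \<and> P c' \<and> c' \<noteq> c)"

lemma other:
  assumes "c \<in> K" "P c"
  shows "other c \<in> orb rt ri c" "P (other c)" "other c \<noteq> c"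
    "{c' \<in> orb rt ri c. P c'} = {c, other c}" "other c \<in> K"
proof -
  have "{c' \<in> orb rt ri c. P c'} \<noteq> {c}"
    using two_pi[OF assms(1)] by auto
  then have "\<exists>c'. c' \<in> orb rt ri c \<and> P c' \<and> c' \<noteq> c"
    using assms orb_self[of c] by auto
  from someI_ex[OF this] show 1: "other c \<in> orb rt ri c" "P (other c)" "other c \<noteq> c"
    by (auto simp: other_def)
  then show "{c' \<in> orb rt ri c. P c'} = {c, other c}"
    using pi_flags_eq assms orb_self by auto
  show "other c \<in> K" using 1(1) orb_subset[OF assms(1)] by blast
qed

lemma other_eq: "c \<in> K \<Longrightarrow> P c \<Longrightarrow> c' \<in> orb rt ri c \<Longrightarrow> P c' \<Longrightarrow> c' \<noteq> c \<Longrightarrow> c' = other c"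
  using other(4)[of c] by auto

lemma other_rv: assumes "c \<in> K" "P c" shows "other (rv c) = rv (other c)"
proof (rule other_eq[symmetric])
  show "rv (other c) \<in> orb rt ri (rv c)" using other assms by (simp add: orb_rv)
  show "rv (other c) \<noteq> rv c" using other[OF assms] assms(1) by (metis rv2)
qed (use other assms in \<open>auto simp: closed P_rv\<close>)

text \<open>Across the lower face \<open>v x y\<close>, turned to the edge \<open>v x\<close>.\<close>
definition left :: "'a \<Rightarrow> 'a" where "left c = ri (nx c)"

text \<open>\<open>c\<close> is a \<open>\<pi>\<close>-flag of a tetrahedron whose two \<open>\<pi>\<close>-edges are both red. Seen from \<open>c\<close>, the
  edge \<open>v w\<close> is the upper one; the opposite flag describes the same tetrahedron upside down.\<close>
definition red_tet :: "'a \<Rightarrow> bool" where "red_tet c \<longleftrightarrow> c \<in> K \<and> P c \<and> red c \<and> red (opp c)"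

text \<open>Across the other lower face \<open>w x y\<close>, turned to the edge \<open>w y\<close>.\<close>
abbreviation down :: "'a \<Rightarrow> 'a" where "down \<equiv> \<lambda>c. rv (left (rv c))"

lemma closed_left: "c \<in> K \<Longrightarrow> left c \<in> K"
  by (simp add: left_def closed)

lemma red_tet_rv: "red_tet c \<Longrightarrow> red_tet (rv c)"
  by (simp add: red_tet_def closed P_rv red_rv opp_rv)

lemma red_tet_opp: "red_tet c \<Longrightarrow> red_tet (opp c)"
  by (simp add: red_tet_def closed P_opp opp_opp)

lemma red_tet_K: "red_tet c \<Longrightarrow> c \<in> K" by (simp add: red_tet_def)

lemma left_alt: "c \<in> K \<Longrightarrow> left c = nx (rt (nx (nx c)))"
  by (simp add: left_def nx_rt closed nx3)

text \<open>The \<open>\<pi>\<close>-angle that the tetrahedron across the face \<open>v x y\<close> has in this face is at \<open>v x\<close>: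
  at \<open>x y\<close> it would make the blue edge \<open>v y\<close> red, and at \<open>v y\<close> it would make the red edge \<open>x y\<close>
  blue.\<close>
lemma P_left: assumes "red_tet c" shows "P (left c)"
proof -
  have c: "c \<in> K" "P c" "red (opp c)" using assms by (auto simp: red_tet_def)
  let ?q = "rt (nx (nx c))"
  have q: "?q \<in> K" by (simp add: c closed)
  have nred: "\<not> red (nx (nx c))"
    using red_zero[of "nx (nx c)"] P_nx_nx P_unique c by (simp add: closed nx3)
  have 1: "\<not> P ?q"
  proof
    assume Pq: "P ?q"
    have K': "rv ?q \<in> K" "nx (nx (rv ?q)) \<in> K" by (auto simp: q closed)
    have Pr: "P (rv ?q)" using Pq P_rv q by simp
    have "rt (rv (opp c)) = nx (nx (rv ?q))"
    proof -
      have "rt (rv (opp c)) = rt (nx (rv (nx (nx c))))"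
        using c by (simp add: nx_rv_nx_nx)
      also have "\<dots> = nx (nx (ri (rv (nx (nx c)))))"
        using c by (simp add: nx_nx_ri closed)
      also have "\<dots> = nx (nx (rv ?q))" using c by (simp add: ri_rv closed)
      finally show ?thesis .
    qed
    moreover have "red (rt (rv (opp c)))"
      using c by (simp add: red_rt red_rv closed)
    moreover have "red (nx (nx (rv ?q))) = P (nx (nx (nx (nx (rv ?q)))))"
      using P_nx_nx[OF K'(1) Pr] K' by (intro red_zero)
    moreover have "\<not> P (nx (rv ?q))" using P_unique[OF K'(1) Pr] .
    ultimately show False by (simp add: nx3 K')
  qed
  have "\<not> P (nx (nx ?q))"
    using red_zero[OF q 1] red_rt[of "nx (nx c)"] nred c by (simp add: closed)
  then show ?thesis using 1 P_some[OF q] left_alt c by auto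
qed

text \<open>A step left and a step down, in either order, are two rotation steps around the lower edge \<open>x y\<close>, one
  way round or the other.\<close>
lemma down_left: assumes "c \<in> K" shows "down (left c) = rt (rt (rv (opp c)))"
proof -
  have "down (left c) = rv (ri (nx (rv (ri (nx c)))))" by (simp add: left_def)
  also have "rv (ri (nx c)) = rt (rv (nx c))" using assms by (simp add: rt_rv closed)
  also have "nx (rt (rv (nx c))) = ri (nx (nx (rv (nx c))))"
    using assms by (simp add: nx_rt closed)
  also have "rv (ri (ri (opp c))) = rt (rt (rv (opp c)))"
    using assms by (simp add: rt_rv closed)
  finally show ?thesis .
qed

lemma left_down: assumes "c \<in> K" shows "left (down c) = ri (ri (rv (opp c)))"
proof -
  have "rv (ri (nx (rv c))) = rt (rv (nx (rv c)))" using assms by (simp add: rt_rv closed)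
  moreover have "nx (rt (rv (nx (rv c)))) = ri (nx (nx (rv (nx (rv c)))))"
    using assms by (simp add: nx_rt closed)
  moreover have "nx (nx (rv (nx (rv c)))) = rv (opp c)"
    using assms by (simp add: opp_rv)
  ultimately show ?thesis by (simp add: left_def)
qed

lemma P_down: "red_tet c \<Longrightarrow> P (down c)"
  using P_left[OF red_tet_rv] by (simp add: red_tet_def P_rv closed closed_left)

text \<open>Both ways around the square end at a \<open>\<pi>\<close>-flag of the lower edge different from the one in
  the square itself. As there are only two, they end at the same flag.\<close>
lemma down_left_other: assumes "red_tet c" "red_tet (left c)" shows "down (left c) = other (rv (opp c))"
proof -
  have K: "c \<in> K" "rv (opp c) \<in> K" "P (rv (opp c))" using assms by (auto simp: red_tet_def closed P_rv P_opp)
  have "rt (rt (rv (opp c))) \<in> orb rt ri (rv (opp c))" using K orb_rt orb_self by simp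
  then show ?thesis
    using K other_eq[OF K(2,3)] down_left[OF K(1)] P_down[OF assms(2)] rt_rt_neq[OF K(2)] by simp
qed

lemma left_down_other: assumes "red_tet c" "red_tet (down c)" shows "left (down c) = other (rv (opp c))"
proof -
  have K: "c \<in> K" "rv (opp c) \<in> K" "P (rv (opp c))" using assms by (auto simp: red_tet_def closed P_rv P_opp)
  have "ri (ri (rv (opp c))) \<in> orb rt ri (rv (opp c))" using K orb_ri orb_self by simp
  moreover have "ri (ri (rv (opp c))) \<noteq> rv (opp c)"
    using rt_rt_neq[of "ri (ri (rv (opp c)))"] K by (simp add: closed(4) rt_ri)
  ultimately show ?thesis
    using K other_eq[OF K(2,3)] left_down[OF K(1)] P_left[OF assms(2)] by simp
qed

text \<open>Going left in the grid is rotating around the edge \<open>v y\<close>.\<close>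
lemma left_pow: assumes "c \<in> K" shows "(left ^^ a) c = nx ((rt ^^ a) (nx (nx c)))"
proof (induction a)
  case 0
  show ?case using assms by (simp add: nx3)
next
  case (Suc a)
  let ?u = "(rt ^^ a) (nx (nx c))"
  have u: "?u \<in> K" using assms by (simp add: closed closed_pow)
  have "(left ^^ Suc a) c = left (nx ?u)" using Suc by simp
  also have "\<dots> = nx (rt ?u)" using u by (simp add: left_alt closed nx3)
  finally show ?case by simp
qed

end

section \<open>Concave edge weights\<close>

text \<open>\<open>N\<close> bounds the length of every fan.\<close>
locale veering_flags_fan_bound = veering_flags +
  fixes N :: nat
  assumes run: "\<And>c k. c \<in> K \<Longrightarrow> (\<And>a. a \<le> k \<Longrightarrow> \<not> P ((rt ^^ a) c)) \<Longrightarrow> k < N"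
begin

definition box_count :: "'a \<Rightarrow> nat" where
  "box_count c = card (boxes red_tet left (\<lambda>c. rv (left (rv c))) c)"

text \<open>An edge is a corner of the grid in which it has two \<open>\<pi>\<close>-flags up to reversal, one on each side. Summing
  over both sides and both flags of each makes the sum independent of what is called
  up, down, left and right.\<close>
definition edge_boxes :: "'a \<Rightarrow> nat" where
  "edge_boxes c = (\<Sum>c' \<in> {c' \<in> orb rt ri c. P c'}. box_count c' + box_count (rv c'))"

text \<open>A row of the grid passes through 0-angles of a single fan.\<close>
lemma red_tet_run: assumes "c \<in> K" "\<And>a. a \<le> j \<Longrightarrow> red_tet ((left ^^ a) c)" shows "j < N"
proof (rule run)
  show "nx (nx c) \<in> K" using assms by (simp add: closed)
  fix a assume "a \<le> j"
  then have "P (nx ((rt ^^ a) (nx (nx c))))" using assms by (simp add: red_tet_def left_pow)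
  then show "\<not> P ((rt ^^ a) (nx (nx c)))" using P_unique[of "(rt ^^ a) (nx (nx c))"] assms(1) by (auto simp: closed closed_pow)
qed

lemma boxes_bounded: "boxes red_tet left down c \<subseteq> {..<N} \<times> {..<N}"
proof (clarify)
  fix i j assume "(i, j) \<in> boxes red_tet left down c"
  then have 1: "red_tet ((down ^^ b) ((left ^^ a) c))" if "a \<le> j" "b \<le> i" for a b
    using that by (simp add: boxes_def)
  have c: "c \<in> K" using 1[of 0 0] by (simp add: red_tet_K)
  have "(down ^^ b) c = rv ((left ^^ b) (rv c)) \<and> (left ^^ b) (rv c) \<in> K" for b
    by (induction b) (auto simp: c rv2 closed closed_left)
  then have "red_tet ((left ^^ b) (rv c))" if "b \<le> i" for b
    using 1[of 0 b] red_tet_rv[of "(down ^^ b) c"] that by (simp add: rv2)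
  then have "i < N" using red_tet_run[of "rv c" i] c by (simp add: closed)
  moreover have "j < N" using red_tet_run[of c j] 1[of _ 0] c by simp
  ultimately show "i \<in> {..<N} \<and> j \<in> {..<N}" by simp
qed

lemma finite_boxes: "finite (boxes red_tet left down c)"
  by (rule finite_subset[OF boxes_bounded]) simp

lemma box_count_le: "box_count c \<le> N\<^sup>2"
  using card_mono[OF _ boxes_bounded, of c] by (simp add: box_count_def power2_eq_square)

lemma box_count_eq_0: "\<not> red_tet c \<Longrightarrow> box_count c = 0"
  by (simp add: box_count_def boxes_empty)

lemma box_count_square:
  assumes "red_tet c"
  shows "box_count (left c) + box_count (down c) + 1 \<le> box_count c + box_count (other (rv (opp c)))"
  unfolding box_count_def
proof (rule card_boxes_supermodular)
  show "left (down s) = down (left s)" if "red_tet s" "red_tet (left s)" "red_tet (down s)" for s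
    using that by (simp add: down_left_other left_down_other)
qed (use assms finite_boxes down_left_other left_down_other in auto)

lemma edge_boxes_pi: assumes "c \<in> K" "P c"
  shows "edge_boxes c = box_count c + box_count (rv c) + box_count (other c) + box_count (rv (other c))"
  using other(3)[OF assms] by (simp add: edge_boxes_def other(4)[OF assms] eq_commute)

lemma edge_boxes_zero: assumes "c \<in> K" "P (ri c)" "P (rt c)"
  shows "edge_boxes c = box_count (ri c) + box_count (rv (ri c)) + box_count (rt c) + box_count (rv (rt c))"
proof -
  have "{c' \<in> orb rt ri c. P c'} = {ri c, rt c}"
    using assms orb_ri orb_rt orb_self rt_neq_ri[OF assms(1)] by (intro pi_flags_eq) auto
  then show ?thesis using rt_neq_ri[OF assms(1)] by (simp add: edge_boxes_def)
qed

lemma edge_boxes_orb: "c \<in> K \<Longrightarrow> c' \<in> orb rt ri c \<Longrightarrow> edge_boxes c' = edge_boxes c"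
  by (simp add: edge_boxes_def orb_eq)

lemma edge_boxes_rt: "c \<in> K \<Longrightarrow> edge_boxes (rt c) = edge_boxes c"
  using edge_boxes_orb orb_rt orb_self by metis

lemma edge_boxes_rv: assumes "c \<in> K" shows "edge_boxes (rv c) = edge_boxes c"
proof -
  have K: "orb rt ri c \<subseteq> K" by (rule orb_subset) fact
  have "{c' \<in> orb rt ri (rv c). P c'} = rv ` {c' \<in> orb rt ri c. P c'}"
    unfolding orb_rv[OF assms] using K P_rv by auto
  moreover have "inj_on rv {c' \<in> orb rt ri c. P c'}"
    using K by (intro inj_on_inverseI[of _ rv]) (auto simp: rv2)
  ultimately show ?thesis
    unfolding edge_boxes_def using K by (auto simp: sum.reindex rv2 add.commute intro!: sum.cong)
qed

lemma edge_boxes_le: assumes "c \<in> K" shows "edge_boxes c \<le> 4 * N\<^sup>2"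
proof -
  have "edge_boxes c \<le> (\<Sum>c' \<in> {c' \<in> orb rt ri c. P c'}. 2 * N\<^sup>2)"
    unfolding edge_boxes_def by (rule sum_mono) (use box_count_le in \<open>metis add_mono mult_2\<close>)
  then show ?thesis using two_pi[OF assms] by simp
qed

lemma edge_boxes_eq_0: assumes "c \<in> K" "\<not> red c" shows "edge_boxes c = 0"
  unfolding edge_boxes_def
proof (intro sum.neutral ballI)
  fix c' assume "c' \<in> {c' \<in> orb rt ri c. P c'}"
  then have "\<not> red c'" "c' \<in> K" using assms red_orb orb_subset by auto
  then show "box_count c' + box_count (rv c') = 0" by (simp add: box_count_eq_0 red_tet_def red_rv)
qed

text \<open>The fan of the red edge \<open>v x\<close> on the side of the tetrahedron consists of this tetrahedron alone, so
  the \<open>\<pi>\<close>-flags of this edge are the left neighbours seen from above and from below.\<close>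
lemma edge_boxes_equator:
  assumes "red_tet c"
  shows "edge_boxes (nx c) = box_count (left c) + box_count (rv (left c)) + box_count (left (opp c)) + box_count (rv (left (opp c)))"
proof -
  have c: "c \<in> K" using assms by (simp add: red_tet_def)
  have K: "nx c \<in> K" "left (opp c) \<in> K" "P (left (opp c))"
    using c P_left[OF red_tet_opp[OF assms]] by (auto simp: closed closed_left)
  have "rv (left (opp c)) = rt (rv (nx (opp c)))" using c by (simp add: left_def rt_rv closed)
  also have "rv (nx (opp c)) = nx c" using c by (simp add: nx3 rv2 closed)
  finally have rt: "rv (left (opp c)) = rt (nx c)" .
  then have "rt (nx c) = rv (left (opp c))" "rv (rt (nx c)) = left (opp c)" "P (rt (nx c))"
    using K by (auto simp: rv2 P_rv closed_left simp flip: rt)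
  then show ?thesis
    using edge_boxes_zero[OF K(1)] P_left[OF assms] by (simp add: left_def)
qed

text \<open>The inequality for rectangles, added up over the four flags on the \<open>\<pi>\<close>-edges of the tetrahedron.\<close>
lemma edge_boxes_square:
  assumes "red_tet c"
  shows "edge_boxes (nx c) + edge_boxes (nx (rv c)) + 4 \<le> edge_boxes c + edge_boxes (opp c)"
proof -
  have c: "c \<in> K" "P c" using assms by (auto simp: red_tet_def)
  have o: "opp c \<in> K" "P (opp c)" using c by (auto simp: closed P_opp)
  have simps: "opp (rv c) = rv (opp c)" "opp (opp c) = c" "opp (rv (opp c)) = rv c" "rv (rv (opp c)) = opp c"
    "rv (rv c) = c" "opp (rv c) = rv (opp c)"
    using c by (auto simp: opp_rv opp_opp rv2 closed)
  note H4 = assms red_tet_rv[OF assms] red_tet_opp[OF assms] red_tet_rv[OF red_tet_opp[OF assms]]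
  note sq = H4[THEN box_count_square, unfolded simps]
  show ?thesis
    using sq edge_boxes_pi[OF c] edge_boxes_pi[OF o] edge_boxes_equator[OF H4(1)] edge_boxes_equator[OF H4(2), unfolded simps]
    by (simp add: other_rv[OF c] other_rv[OF o])
qed

text \<open>Reversing the orientation exchanges before and after, hence the colours.\<close>
lemma mirror: "veering_flags_fan_bound K (\<lambda>c. nx (nx c)) rv ri rt P (\<lambda>c. \<not> red c) N"
proof
  fix c assume c: "c \<in> K"
  show "rv (nx (nx (rv c))) = nx (nx (nx (nx (rv (nx (nx (nx (nx c))))))))"
    using nx_rv_nx[OF c] c by (simp add: closed nx3)
  show "ri (nx (nx (ri c))) = nx (nx (nx (nx c)))"
    using c by (simp add: nx_nx_ri closed nx3 ri_rt)
  show "P (nx (nx (nx (nx (rv (nx (nx c))))))) = P c"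
    using P_opp[OF c] P_rv[of "opp c"] nx_rv_nx_nx[OF c] c by (simp add: closed nx3)
  show "P c \<or> P (nx (nx c)) \<or> P (nx (nx (nx (nx c))))"
    using P_some[OF c] by (auto simp: closed nx3 c)
  show "(\<not> red (ri c)) = (\<not> red c)"
    using red_rt[of "ri c"] c by (simp add: closed rt_ri)
  show "card {c' \<in> orb ri rt c. P c'} = 2"
    using two_pi[OF c] by (simp add: orb_def Un_commute)
  show "(\<not> red c) = P (nx (nx (nx (nx c))))" if "\<not> P c"
    using red_zero[OF c that] P_some[OF c] P_unique[of "nx c"] that c by (auto simp: closed nx3)
  show "k < N" if "\<And>a. a \<le> k \<Longrightarrow> \<not> P ((ri ^^ a) c)" for k
  proof (rule run)
    fix a assume "a \<le> k"
    then have "(ri ^^ k) c = (ri ^^ a) ((ri ^^ (k - a)) c)"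
      using funpow_add[of a "k - a" ri] by simp
    then have "(rt ^^ a) ((ri ^^ k) c) = (ri ^^ (k - a)) c"
      using c by (simp add: rt_pow_ri_pow closed_pow)
    then show "\<not> P ((rt ^^ a) ((ri ^^ k) c))" using that by simp
  qed (use c closed_pow in auto)
qed (auto simp: fin closed nx3 rv2 ri_rt rt_ri ri_rv P_rv P_nx_nx red_rv rv_neq ri_neq_rv)

definition signed :: "('a \<Rightarrow> real) \<Rightarrow> 'a \<Rightarrow> real" where
  "signed x c = (if red c then x c else - x c)"

text \<open>The increase of the 0-angle at the blue equatorial edges, where \<open>c\<close> is a \<open>\<pi>\<close>-flag. \<open>T\<close>
  is the mirror image of \<open>edge_boxes\<close>, abstracted to the properties that matter. Only two red \<open>\<pi>\<close>-edges
  require the concavity; otherwise the positive terms have at least \<open>3 N\<^sup>2\<close> against at most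
  \<open>2 N\<^sup>2\<close>.\<close>
lemma equator_angle:
  assumes T: "\<And>c. c \<in> K \<Longrightarrow> T c \<le> 4 * N\<^sup>2" "\<And>c. c \<in> K \<Longrightarrow> red c \<Longrightarrow> T c = 0"
    and x: "\<And>c. x c = 2 * (real N)\<^sup>2 - (real (edge_boxes c) + real (T c)) / 4"
    and c: "c \<in> K" "P c"
  shows "signed x (nx c) + signed x (nx (rv c)) - signed x c - signed x (opp c) \<ge> 1"
proof -
  have K: "nx c \<in> K" "rv c \<in> K" "nx (rv c) \<in> K" "opp c \<in> K" "P (rv c)"
    using c by (auto simp: closed P_rv)
  have red: "red (nx c)" "red (nx (rv c))"
    using red_zero[OF K(1)] red_zero[OF K(3)] P_unique c K by (auto simp: nx3)
  have "0 < N" using run[of "nx c" 0] P_unique[OF c] K by simp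
  then have N: "(real N)\<^sup>2 \<ge> 1" by simp
  have x_le: "x c' \<le> 2 * (real N)\<^sup>2" for c' by (simp add: x)
  have x_ge: "x c' \<ge> (real N)\<^sup>2" if "c' \<in> K" for c'
  proof -
    have "edge_boxes c' + T c' \<le> 4 * N\<^sup>2"
      using edge_boxes_le[OF that] T[OF that] edge_boxes_eq_0[OF that] by (cases "red c'") auto
    then have "real (edge_boxes c' + T c') \<le> real (4 * N\<^sup>2)" by (rule of_nat_mono)
    then show ?thesis by (simp add: x)
  qed
  note bounds = x_ge[OF K(1)] x_ge[OF K(3)] x_ge[OF c(1)] x_ge[OF K(4)] x_le[of c] x_le[of "opp c"] N
  show ?thesis
  proof (cases "red c \<and> red (opp c)")
    case True
    then have "red_tet c" using c by (simp add: red_tet_def)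
    from edge_boxes_square[OF this] have "real (edge_boxes (nx c)) + real (edge_boxes (nx (rv c))) + 4 \<le> real (edge_boxes c) + real (edge_boxes (opp c))"
      by linarith
    then show ?thesis using True red T(2) K c by (simp add: signed_def x)
  next
    case False
    then show ?thesis using bounds red by (auto simp: signed_def)
  qed
qed

text \<open>One weight serves both colours, as \<open>edge_boxes\<close> vanishes on blue edges and its mirror image on red
  ones. The two kinds of 0-angle are then treated by \<open>equator_angle\<close> and its mirror image.\<close>
theorem edge_weights_exist:
  "\<exists>X :: 'a \<Rightarrow> real. \<forall>c\<in>K. X (rt c) = X c \<and> X (rv c) = X c \<and>
     (if P c then - 8 * (real N)\<^sup>2 else 1)
       \<le> X (nx (nx c)) + X (nx (nx (rv c))) - X (nx c) - X (nx (rv c))"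
proof -
  interpret M: veering_flags_fan_bound K "\<lambda>c. nx (nx c)" rv ri rt P "\<lambda>c. \<not> red c" N
    by (rule mirror)
  define x where "x c = 2 * (real N)\<^sup>2 - (real (edge_boxes c) + real (M.edge_boxes c)) / 4" for c
  let ?W = "\<lambda>c. signed x (nx (nx c)) + signed x (nx (nx (rv c))) - signed x (nx c) - signed x (nx (rv c))"
  have M_signed: "M.signed x c = - signed x c" for c
    by (simp add: M.signed_def signed_def)
  have inv: "signed x (rt c) = signed x c" "signed x (rv c) = signed x c" if "c \<in> K" for c
    using that M.edge_boxes_rt[of "rt c"] by (auto simp: signed_def red_rt red_rv x_def edge_boxes_rt edge_boxes_rv M.edge_boxes_rv ri_rt closed)
  have "\<bar>signed x c\<bar> \<le> 2 * (real N)\<^sup>2" if "c \<in> K" for c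
  proof -
    have "edge_boxes c + M.edge_boxes c \<le> 4 * N\<^sup>2"
      using edge_boxes_le[OF that] M.edge_boxes_le[OF that] edge_boxes_eq_0[OF that] M.edge_boxes_eq_0[OF that] by (cases "red c") auto
    then have "real (edge_boxes c + M.edge_boxes c) \<le> real (4 * N\<^sup>2)" by (rule of_nat_mono)
    then show ?thesis by (simp add: signed_def x_def abs_le_iff)
  qed
  note bound = this
  have "?W c \<ge> - 8 * (real N)\<^sup>2" if "c \<in> K" for c
    using bound[of "nx (nx c)"] bound[of "nx (nx (rv c))"] bound[of "nx c"] bound[of "nx (rv c)"] that
    by (simp add: closed abs_le_iff)
  moreover have "?W c \<ge> 1" if c: "c \<in> K" "\<not> P c" for c
  proof (cases "P (nx c)")
    case True
    let ?p = "nx c"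
    have K: "?p \<in> K" using c by (simp add: closed)
    have "signed x (nx ?p) + signed x (nx (rv ?p)) - signed x ?p - signed x (opp ?p) \<ge> 1"
      using K True M.edge_boxes_le M.edge_boxes_eq_0 by (intro equator_angle[where T = M.edge_boxes]) (auto simp: x_def)
    moreover have "nx (rv ?p) = rv (nx (nx (rv c)))"
      using c(1) by (rule nx_rv_nx)
    moreover have "opp ?p = rv (nx (rv c))"
      using c by (simp add: closed rv_nx_rv nx3)
    ultimately show ?thesis using c by (simp add: inv closed)
  next
    case False
    let ?p = "nx (nx c)"
    have K: "?p \<in> K" and P: "P ?p" using c False P_some by (auto simp: closed)
    have "M.signed x (nx (nx ?p)) + M.signed x (nx (nx (rv ?p))) - M.signed x ?p
        - M.signed x (nx (nx (nx (nx (rv (nx (nx ?p))))))) \<ge> 1"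
      using K P edge_boxes_le edge_boxes_eq_0 by (intro M.equator_angle[where T = edge_boxes]) (auto simp: x_def)
    moreover have "nx (nx (rv ?p)) = rv (nx (rv c))"
      using c by (simp add: rv_nx_rv)
    moreover have "rv (nx (nx (rv c))) = nx (rv (nx c))"
      using c(1) by (rule nx_rv_nx[symmetric])
    ultimately show ?thesis using c inv(2)[of "nx (nx (rv c))"] inv(2)[of "nx (rv c)"]
      by (simp add: M_signed closed nx3)
  qed
  ultimately show ?thesis using inv by (intro exI[of _ "signed x"]) auto
qed

end

section \<open>Orientation and opposite edges in a single tetrahedron\<close>

lemma ccw_range: "ccw v w x y \<Longrightarrow> {v, w, x, y} = {..<4}"
proof -
  assume "ccw v w x y"
  then have "(\<lambda>i. if i < 4 then [v, w, x, y] ! i else i) permutes {..<4}" (is "?p permutes _")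
    by (simp add: ccw_def Let_def)
  then have "?p ` {..<4} = {..<4}" by (rule permutes_image)
  then show ?thesis by (simp add: lessThan_Suc numeral_eq_Suc insert_commute)
qed

lemma arrangement_permutes:
  assumes "{v, w, x, y} = {..<4::nat}"
  shows "(\<lambda>i. if i < 4 then [v, w, x, y] ! i else i) permutes {..<4}" (is "?p permutes _")
proof (rule bij_imp_permutes)
  have im: "?p ` {..<4} = {..<4}"
    using assms by (simp add: lessThan_Suc numeral_eq_Suc insert_commute)
  then have "inj_on ?p {..<4}" by (intro finite_surj_inj) auto
  with im show "bij_betw ?p {..<4} {..<4}" by (simp add: bij_betw_def)
qed simp

lemma ccw_transpose:
  assumes "{v, w, x, y} = {..<4}"
  shows "ccw w v x y \<longleftrightarrow> \<not> ccw v w x y" "ccw v x w y \<longleftrightarrow> \<not> ccw v w x y" "ccw v w y x \<longleftrightarrow> \<not> ccw v w x y"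
proof -
  let ?p = "\<lambda>v w x y i. if i < 4 then [v, w, x, y] ! i else i :: nat"
  have perm: "permutation (?p v w x y)"
    using arrangement_permutes[OF assms] by (auto simp: permutation_permutes)
  have sw: "evenperm (?p v w x y \<circ> Transposition.transpose a b) \<longleftrightarrow> \<not> evenperm (?p v w x y)" if "a \<noteq> b" for a b
    using that perm by (simp add: evenperm_comp permutation_swap_id evenperm_swap)
  have "?p w v x y = ?p v w x y \<circ> Transposition.transpose 0 1" "?p v x w y = ?p v w x y \<circ> Transposition.transpose 1 2"
    "?p v w y x = ?p v w x y \<circ> Transposition.transpose 2 3"
    by (auto simp: fun_eq_iff Transposition.transpose_def numeral_eq_Suc less_Suc_eq)
  then show "ccw w v x y \<longleftrightarrow> \<not> ccw v w x y" "ccw v x w y \<longleftrightarrow> \<not> ccw v w x y" "ccw v w y x \<longleftrightarrow> \<not> ccw v w x y"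
    using arrangement_permutes[OF assms] arrangement_permutes[of w v x y]
      arrangement_permutes[of v x w y] arrangement_permutes[of v w y x] assms sw[of 0 1] sw[of 1 2] sw[of 2 3]
    by (simp_all add: ccw_def Let_def insert_commute)
qed

lemma ccw_turn: assumes "ccw v w x y" shows "ccw v x y w"
proof -
  have r: "{v, w, x, y} = {..<4}" "{v, x, w, y} = {..<4}" using ccw_range[OF assms] by auto
  show ?thesis using assms ccw_transpose(2)[OF r(1)] ccw_transpose(3)[OF r(2)] by simp
qed

lemma ccw_flip: assumes "ccw v w x y" shows "ccw w v y x"
proof -
  have r: "{v, w, x, y} = {..<4}" "{w, v, x, y} = {..<4}" using ccw_range[OF assms] by auto
  show ?thesis using assms ccw_transpose(1)[OF r(1)] ccw_transpose(3)[OF r(2)] by simp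
qed

lemma ccw_less: assumes "ccw v w x y" shows "v < 4" "w < 4" "x < 4" "y < 4"
  using ccw_range[OF assms] by auto

lemma ccw_distinct: assumes "ccw v w x y"
  shows "v \<noteq> w" "v \<noteq> x" "v \<noteq> y" "w \<noteq> x" "w \<noteq> y" "x \<noteq> y"
proof -
  have "card {v, w, x, y} = 4" using ccw_range[OF assms] by simp
  then show "v \<noteq> w" "v \<noteq> x" "v \<noteq> y" "w \<noteq> x" "w \<noteq> y" "x \<noteq> y"
    by (auto simp: card_insert_if split: if_splits)
qed

lemma ccw_unique: assumes "ccw v w x y" "ccw v w x' y'" shows "x' = x" "y' = y"
proof -
  have "{x, y} = {..<4} - {v, w}" "{x', y'} = {..<4} - {v, w}"
    using ccw_range[OF assms(1)] ccw_range[OF assms(2)] ccw_distinct[OF assms(1)] ccw_distinct[OF assms(2)]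
    by auto
  then have "(x' = x \<and> y' = y) \<or> (x' = y \<and> y' = x)" by (metis doubleton_eq_iff)
  moreover have "\<not> ccw v w y x" using ccw_transpose(3)[OF ccw_range] assms(1) by blast
  ultimately show "x' = x" "y' = y" using assms by auto
qed

lemma ccw_0123: "ccw 0 1 2 3"
proof -
  have "(\<lambda>i. if i < 4 then [0, 1, 2, 3] ! i else i) = (id :: nat \<Rightarrow> nat)"
    by (auto simp: fun_eq_iff numeral_eq_Suc less_Suc_eq)
  then show ?thesis unfolding ccw_def Let_def by (simp only: permutes_id evenperm_id simp_thms)
qed

lemma ccw_exists: assumes "v < 4" "w < 4" "v \<noteq> w" obtains x y where "ccw v w x y"
proof -
  have "card ({..<4} - {v, w}) = 2" using assms by (simp add: card_Diff_subset)
  then obtain x y where xy: "{..<4} - {v, w} = {x, y}" unfolding card_2_iff by blast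
  have "{v, w} \<union> ({..<4} - {v, w}) = {..<4}" using assms by auto
  then have "{v, w, x, y} = {..<4}" unfolding xy by (simp add: insert_commute)
  from ccw_transpose(3)[OF this] show ?thesis using that[of x y] that[of y x] by blast
qed

text \<open>An odd gluing reverses the cyclic order, which the exchange of the last two entries restores.
  Crossing a face therefore leads to flags again.\<close>
lemma ccw_odd_image:
  assumes "ccw v w x y" "\<sigma> permutes {..<4}" "\<not> evenperm \<sigma>"
  shows "ccw (\<sigma> v) (\<sigma> w) (\<sigma> y) (\<sigma> x)"
proof -
  have r: "{\<sigma> v, \<sigma> w, \<sigma> x, \<sigma> y} = {..<4}"
    using arg_cong[OF ccw_range[OF assms(1)], of "image \<sigma>"] permutes_image[OF assms(2)] by simp
  have "(\<lambda>i. if i < 4 then [\<sigma> v, \<sigma> w, \<sigma> x, \<sigma> y] ! i else i)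
      = \<sigma> \<circ> (\<lambda>i. if i < 4 then [v, w, x, y] ! i else i)"
    using permutes_not_in[OF assms(2)] by (auto simp: fun_eq_iff numeral_eq_Suc less_Suc_eq)
  moreover have "permutation \<sigma>" using assms(2) by (auto simp: permutation_permutes)
  moreover have "permutation (\<lambda>i. if i < 4 then [v, w, x, y] ! i else i)"
    using arrangement_permutes[OF ccw_range[OF assms(1)]] by (auto simp: permutation_permutes)
  ultimately have "\<not> ccw (\<sigma> v) (\<sigma> w) (\<sigma> x) (\<sigma> y)"
    using assms by (simp add: ccw_def Let_def evenperm_comp)
  then show ?thesis using ccw_transpose(3)[OF r] by simp
qed

lemma all_less_4: "(\<forall>v<4. Q v) \<longleftrightarrow> Q 0 \<and> Q 1 \<and> Q 2 \<and> Q (3 :: nat)"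
  by (auto simp: numeral_eq_Suc All_less_Suc)

lemma opposite_pair_simps:
  "opposite_pair {0, 1} = 0" "opposite_pair {1, 0} = 0" "opposite_pair {2, 3} = 0" "opposite_pair {3, 2} = 0"
  "opposite_pair {0, 2} = 1" "opposite_pair {2, 0} = 1" "opposite_pair {1, 3} = 1" "opposite_pair {3, 1} = 1"
  "opposite_pair {0, 3} = 2" "opposite_pair {3, 0} = 2" "opposite_pair {1, 2} = 2" "opposite_pair {2, 1} = 2"
  by (simp_all add: opposite_pair_def doubleton_eq_iff)

lemma opposite_pair_ccw:
  assumes "ccw v w x y"
  shows "opposite_pair {x, y} = opposite_pair {v, w}"
    "(opposite_pair {v, w}, opposite_pair {v, x}, opposite_pair {v, y})
       \<in> {(0, 1, 2), (0, 2, 1), (1, 0, 2), (1, 2, 0), (2, 0, 1), (2, 1, 0)}"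
proof -
  have "\<forall>v<4. \<forall>w<4. \<forall>x<4. \<forall>y<4. v \<noteq> w \<longrightarrow> v \<noteq> x \<longrightarrow> v \<noteq> y \<longrightarrow> w \<noteq> x \<longrightarrow> w \<noteq> y \<longrightarrow> x \<noteq> y \<longrightarrow>
      opposite_pair {x, y} = opposite_pair {v, w} \<and>
      (opposite_pair {v, w}, opposite_pair {v, x}, opposite_pair {v, y})
        \<in> {(0, 1, 2), (0, 2, 1), (1, 0, 2), (1, 2, 0), (2, 0, 1), (2, 1, 0)}"
    unfolding all_less_4 by (simp add: opposite_pair_simps opposite_pair_simps[simplified])
  note * = this[rule_format, OF ccw_less[OF assms] ccw_distinct[OF assms]]
  show "opposite_pair {x, y} = opposite_pair {v, w}" using * by (rule conjunct1)
  show "(opposite_pair {v, w}, opposite_pair {v, x}, opposite_pair {v, y})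
       \<in> {(0, 1, 2), (0, 2, 1), (1, 0, 2), (1, 2, 0), (2, 0, 1), (2, 1, 0)}"
    using * by (rule conjunct2)
qed

lemma opposite_pair_eq_iff: assumes "ccw v w x y" "v' < 4" "w' < 4" "v' \<noteq> w'"
    "opposite_pair {v', w'} = opposite_pair {v, w}"
  shows "(v', w') \<in> {(v, w), (w, v), (x, y), (y, x)}"
proof -
  define p where "p a b = opposite_pair {a, b}" for a b
  have r: "v' \<in> {v, w, x, y}" "w' \<in> {v, w, x, y}"
    using assms(2,3) ccw_range[OF assms(1)] by simp_all
  have sym: "p w v = p v w" "p x v = p v x" "p y v = p v y" "p x w = p w x" "p y w = p w y" "p y x = p x y"
    by (simp_all add: p_def insert_commute)
  have opp: "p x y = p v w" "p w y = p v x" "p w x = p v y"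
    using opposite_pair_ccw(1)[OF assms(1)] opposite_pair_ccw(1)[OF ccw_turn[OF assms(1)]]
      opposite_pair_ccw(1)[OF ccw_turn[OF ccw_turn[OF assms(1)]]] by (simp_all add: p_def insert_commute)
  have "p v x \<noteq> p v w" "p v y \<noteq> p v w"
    using opposite_pair_ccw(2)[OF assms(1)] by (auto simp: p_def)
  moreover have "p v' w' = p v w" using assms(5) by (simp add: p_def)
  ultimately show ?thesis
    using r assms(4) by (elim insertE emptyE; simp add: sym opp)
qed

section \<open>The flags of a triangulation\<close>

text \<open>The tetrahedron followed by an even ordering of its vertices.\<close>
type_synonym flag = "nat \<times> nat \<times> nat \<times> nat \<times> nat"

definition flags :: "triangulation \<Rightarrow> flag set" where
  "flags \<tau> = {(t, v, w, x, y). t < tets \<tau> \<and> ccw v w x y}"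

fun turn :: "flag \<Rightarrow> flag" where "turn (t, v, w, x, y) = (t, v, x, y, w)"

fun flip :: "flag \<Rightarrow> flag" where "flip (t, v, w, x, y) = (t, w, v, y, x)"

fun cross :: "triangulation \<Rightarrow> flag \<Rightarrow> flag" where
  "cross \<tau> (t, v, w, x, y) =
     (nbr \<tau> t x, glue \<tau> t x v, glue \<tau> t x w, glue \<tau> t x y, glue \<tau> t x x)"

fun cross_back :: "triangulation \<Rightarrow> flag \<Rightarrow> flag" where
  "cross_back \<tau> (t, v, w, x, y) =
     (nbr \<tau> t y, glue \<tau> t y v, glue \<tau> t y w, glue \<tau> t y y, glue \<tau> t y x)"

fun tet_edge :: "flag \<Rightarrow> nat \<times> nat set" where "tet_edge (t, v, w, x, y) = (t, {v, w})"

fun corner_of :: "flag \<Rightarrow> corner" where "corner_of (t, v, w, x, y) = (t, v, w)"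

context
  fixes \<tau> :: triangulation
  assumes gluing: "oriented_gluing \<tau>"
begin

lemma glueD:
  assumes "t < tets \<tau>" "f < 4"
  shows "nbr \<tau> t f < tets \<tau>" "glue \<tau> t f permutes {..<4}" "\<not> evenperm (glue \<tau> t f)"
    "(nbr \<tau> t f, glue \<tau> t f f) \<noteq> (t, f)" "nbr \<tau> (nbr \<tau> t f) (glue \<tau> t f f) = t"
    "glue \<tau> (nbr \<tau> t f) (glue \<tau> t f f) (glue \<tau> t f v) = v"
proof -
  show "nbr \<tau> t f < tets \<tau>" and perm: "glue \<tau> t f permutes {..<4}" and "\<not> evenperm (glue \<tau> t f)"
    "(nbr \<tau> t f, glue \<tau> t f f) \<noteq> (t, f)" "nbr \<tau> (nbr \<tau> t f) (glue \<tau> t f f) = t"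
    using gluing assms by (auto simp: oriented_gluing_def)
  have "glue \<tau> (nbr \<tau> t f) (glue \<tau> t f f) = inv (glue \<tau> t f)"
    using gluing assms by (auto simp: oriented_gluing_def)
  then show "glue \<tau> (nbr \<tau> t f) (glue \<tau> t f f) (glue \<tau> t f v) = v"
    using permutes_inverses(2)[OF perm] by simp
qed

lemma oriented_flags: "oriented_flags (flags \<tau>) turn flip (cross \<tau>) (cross_back \<tau>)"
proof
  have "flags \<tau> \<subseteq> {..<tets \<tau>} \<times> {..<4} \<times> {..<4} \<times> {..<4} \<times> {..<4}"
    by (auto simp: flags_def dest: ccw_less)
  then show "finite (flags \<tau>)" by (rule finite_subset) auto
  fix c assume "c \<in> flags \<tau>"
  then obtain t v w x y where c: "c = (t, v, w, x, y)" "t < tets \<tau>" "ccw v w x y"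
    by (auto simp: flags_def)
  note lt = ccw_less[OF c(3)] and ne = ccw_distinct[OF c(3)]
  note gx = glueD[OF c(2) lt(3)] and gy = glueD[OF c(2) lt(4)]
  show "turn c \<in> flags \<tau>" "flip c \<in> flags \<tau>" 
    using ccw_turn[OF c(3)] ccw_flip[OF c(3)] c(2) by (simp_all add: c(1) flags_def)
  show "cross \<tau> c \<in> flags \<tau>" "cross_back \<tau> c \<in> flags \<tau>"
    using gx(1) gy(1) ccw_odd_image[OF c(3) gx(2,3)] ccw_odd_image[OF c(3) gy(2,3)]
    by (simp_all add: c(1) flags_def)
  show "turn (turn (turn c)) = c" "flip (flip c) = c" by (simp_all add: c)
  show "flip (turn (flip c)) = turn (turn (flip (turn (turn c))))" by (simp add: c)
  show "cross_back \<tau> (cross \<tau> c) = c" "cross \<tau> (cross_back \<tau> c) = c"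
    using gx(5,6) gy(5,6) by (simp_all add: c(1))
  show "cross \<tau> (flip c) = flip (cross_back \<tau> c)" by (simp add: c)
  show "cross \<tau> (turn (cross \<tau> c)) = turn (turn c)" using gx(5,6) by (simp add: c(1))
  show "flip c \<noteq> c" using ne by (auto simp: c(1))
  show "cross \<tau> c \<noteq> flip c" using gx(4) by (auto simp: c(1))
qed

interpretation oriented_flags "flags \<tau>" turn flip "cross \<tau>" "cross_back \<tau>"
  by (rule oriented_flags)

lemma inj_on_tet_edge: assumes "c \<in> flags \<tau>"
  shows "inj_on tet_edge (orb (cross \<tau>) (cross_back \<tau>) c)"
proof
  fix c1 c2 assume orb: "c1 \<in> orb (cross \<tau>) (cross_back \<tau>) c" "c2 \<in> orb (cross \<tau>) (cross_back \<tau>) c"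
    and eq: "tet_edge c1 = tet_edge c2"
  have K: "c1 \<in> flags \<tau>" "c2 \<in> flags \<tau>" using orb orb_subset[OF assms] by auto
  obtain t v w x y where c1: "c1 = (t, v, w, x, y)" by (metis prod_cases5)
  obtain t' v' w' x' y' where c2: "c2 = (t', v', w', x', y')" by (metis prod_cases5)
  have "c2 = c1 \<or> c2 = flip c1"
    using eq K ccw_unique[of v w x y x' y'] ccw_unique[of w v y x x' y'] ccw_flip[of v w x y]
    by (auto simp: c1 c2 flags_def doubleton_eq_iff)
  moreover have "c2 \<noteq> flip c1" using rv_notin_orb[OF K(1)] orb_eq[OF assms orb(1)] orb(2) by auto
  ultimately show "c1 = c2" by simp
qed

lemma flag_of_corner: assumes "t < tets \<tau>" "v < 4" "w < 4" "v \<noteq> w"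
  obtains c where "c \<in> flags \<tau>" "corner_of c = (t, v, w)" "tet_edge c = (t, {v, w})"
proof -
  obtain x y where "ccw v w x y" using ccw_exists[OF assms(2-4)] .
  then show ?thesis using that[of "(t, v, w, x, y)"] assms(1) by (simp add: flags_def)
qed

lemma neighbour_cases:
  assumes "(t, v, w, x, y) \<in> flags \<tau>" "f < 4" "f \<noteq> v" "f \<noteq> w"
  shows "f = x \<or> f = y"
proof -
  have "{v, w, x, y} = {..<4}" using assms(1) ccw_range by (simp add: flags_def)
  then have "f \<in> {v, w, x, y}" using assms(2) by blast
  then show ?thesis using assms(3,4) by simp
qed

text \<open>An edge of a tetrahedron lies in the two faces opposite to the other two vertices, and the rotation
  crosses one of them and the inverse rotation the other one.\<close>
lemma edge_class_eq: assumes "c \<in> flags \<tau>"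
  shows "(edge_pairing \<tau>)\<^sup>* `` {tet_edge c} = tet_edge ` orb (cross \<tau>) (cross_back \<tau>) c"
proof
  have step: "(tet_edge z, tet_edge (cross \<tau> z)) \<in> edge_pairing \<tau>"
    "(tet_edge z, tet_edge (cross_back \<tau> z)) \<in> edge_pairing \<tau>" if zK: "z \<in> flags \<tau>" for z
  proof -
    obtain t v w x y where z: "z = (t, v, w, x, y)" "t < tets \<tau>" "ccw v w x y"
      using zK by (auto simp: flags_def)
    note z' = ccw_less[OF z(3)] ccw_distinct[OF z(3)]
    have *: "((t, {v, w}), (nbr \<tau> t f, glue \<tau> t f ` {v, w})) \<in> edge_pairing \<tau>"
      if "f < 4" "f \<notin> {v, w}" for f
      unfolding edge_pairing_def mem_Collect_eq
      by (intro exI[of _ t] exI[of _ "{v, w}"] exI[of _ f]) (use z(2) z' that in \<open>simp add: tet_edges_def\<close>)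
    show "(tet_edge z, tet_edge (cross \<tau> z)) \<in> edge_pairing \<tau>"
      "(tet_edge z, tet_edge (cross_back \<tau> z)) \<in> edge_pairing \<tau>"
      using *[of x] *[of y] z' by (auto simp: z(1))
  qed
  have "orb (cross \<tau>) (cross_back \<tau>) c \<subseteq> {z \<in> flags \<tau>. (tet_edge c, tet_edge z) \<in> (edge_pairing \<tau>)\<^sup>*}"
    by (rule orb_minimal) (auto simp: assms closed intro: rtrancl.rtrancl_into_rtrancl step)
  then show "tet_edge ` orb (cross \<tau>) (cross_back \<tau>) c \<subseteq> (edge_pairing \<tau>)\<^sup>* `` {tet_edge c}"
    by auto
  show "(edge_pairing \<tau>)\<^sup>* `` {tet_edge c} \<subseteq> tet_edge ` orb (cross \<tau>) (cross_back \<tau>) c"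
  proof
    fix q assume "q \<in> (edge_pairing \<tau>)\<^sup>* `` {tet_edge c}"
    then have "(tet_edge c, q) \<in> (edge_pairing \<tau>)\<^sup>*" by simp
    then show "q \<in> tet_edge ` orb (cross \<tau>) (cross_back \<tau>) c"
    proof (induction rule: rtrancl_induct)
      case base
      show ?case using orb_self by blast
    next
      case (step q q')
      then obtain z where z: "z \<in> orb (cross \<tau>) (cross_back \<tau>) c" "q = tet_edge z" by blast
      obtain t v w x y where zt: "z = (t, v, w, x, y)" by (metis prod_cases5)
      obtain f where f: "f < 4" "f \<notin> {v, w}" "q' = (nbr \<tau> t f, glue \<tau> t f ` {v, w})"
        using step.hyps(2) z(2) by (auto simp: edge_pairing_def zt)
      have "f = x \<or> f = y"
        using neighbour_cases[of t v w x y f] f z(1) orb_subset[OF assms] zt by auto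
      then have "q' = tet_edge (cross \<tau> z) \<or> q' = tet_edge (cross_back \<tau> z)"
        using f(3) by (auto simp: zt)
      then show ?case using orb_rt[OF assms z(1)] orb_ri[OF assms z(1)] by blast
    qed
  qed
qed

lemma corner_class_eq: assumes "c \<in> flags \<tau>"
  shows "(corner_pairing \<tau>)\<^sup>* `` {corner_of c} = corner_of ` orb (cross \<tau>) (cross_back \<tau>) c"
proof
  have step: "(corner_of z, corner_of (cross \<tau> z)) \<in> corner_pairing \<tau>"
    "(corner_of z, corner_of (cross_back \<tau> z)) \<in> corner_pairing \<tau>" if zK: "z \<in> flags \<tau>" for z
  proof -
    obtain t v w x y where z: "z = (t, v, w, x, y)" "t < tets \<tau>" "ccw v w x y"
      using zK by (auto simp: flags_def)
    note z' = ccw_less[OF z(3)] ccw_distinct[OF z(3)]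
    have *: "((t, v, w), (nbr \<tau> t f, glue \<tau> t f v, glue \<tau> t f w)) \<in> corner_pairing \<tau>"
      if "f < 4" "f \<noteq> v" "f \<noteq> w" for f
      unfolding corner_pairing_def mem_Collect_eq
      by (intro exI[of _ t] exI[of _ v] exI[of _ w] exI[of _ f]) (use z(2) z' that in \<open>simp add: corners_def\<close>)
    show "(corner_of z, corner_of (cross \<tau> z)) \<in> corner_pairing \<tau>"
      "(corner_of z, corner_of (cross_back \<tau> z)) \<in> corner_pairing \<tau>"
      using *[of x] *[of y] z' by (auto simp: z(1))
  qed
  have "orb (cross \<tau>) (cross_back \<tau>) c \<subseteq> {z \<in> flags \<tau>. (corner_of c, corner_of z) \<in> (corner_pairing \<tau>)\<^sup>*}"
    by (rule orb_minimal) (auto simp: assms closed intro: rtrancl.rtrancl_into_rtrancl step)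
  then show "corner_of ` orb (cross \<tau>) (cross_back \<tau>) c \<subseteq> (corner_pairing \<tau>)\<^sup>* `` {corner_of c}"
    by auto
  show "(corner_pairing \<tau>)\<^sup>* `` {corner_of c} \<subseteq> corner_of ` orb (cross \<tau>) (cross_back \<tau>) c"
  proof
    fix q assume "q \<in> (corner_pairing \<tau>)\<^sup>* `` {corner_of c}"
    then have "(corner_of c, q) \<in> (corner_pairing \<tau>)\<^sup>*" by simp
    then show "q \<in> corner_of ` orb (cross \<tau>) (cross_back \<tau>) c"
    proof (induction rule: rtrancl_induct)
      case base
      show ?case using orb_self by blast
    next
      case (step q q')
      then obtain z where z: "z \<in> orb (cross \<tau>) (cross_back \<tau>) c" "q = corner_of z" by blast
      obtain t v w x y where zt: "z = (t, v, w, x, y)" by (metis prod_cases5)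
      obtain f where f: "f < 4" "f \<noteq> v" "f \<noteq> w" "q' = (nbr \<tau> t f, glue \<tau> t f v, glue \<tau> t f w)"
        using step.hyps(2) z(2) by (auto simp: corner_pairing_def zt)
      have "f = x \<or> f = y"
        using neighbour_cases[of t v w x y f] f z(1) orb_subset[OF assms] zt by auto
      then have "q' = corner_of (cross \<tau> z) \<or> q' = corner_of (cross_back \<tau> z)"
        using f(4) by (auto simp: zt)
      then show ?case using orb_rt[OF assms z(1)] orb_ri[OF assms z(1)] by blast
    qed
  qed
qed

lemma edge_class_in_edges: assumes "c \<in> flags \<tau>"
  shows "tet_edge ` orb (cross \<tau>) (cross_back \<tau>) c \<in> edges \<tau>"
proof -
  have "tet_edge c \<in> tet_edges \<tau>"
    using assms ccw_less ccw_distinct by (auto simp: flags_def tet_edges_def)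
  then show ?thesis unfolding edges_def edge_class_eq[OF assms, symmetric] by (rule quotientI)
qed

lemma edges_cases: assumes "E \<in> edges \<tau>"
  obtains c where "c \<in> flags \<tau>" "E = tet_edge ` orb (cross \<tau>) (cross_back \<tau>) c"
proof -
  obtain t e where te: "(t, e) \<in> tet_edges \<tau>" "E = (edge_pairing \<tau>)\<^sup>* `` {(t, e)}"
    using assms by (auto simp: edges_def elim!: quotientE)
  then obtain v w where "e = {v, w}" "v \<noteq> w" "v < 4" "w < 4" "t < tets \<tau>"
    by (auto simp: tet_edges_def card_2_iff)
  then show ?thesis using flag_of_corner[of t v w] te(2) that edge_class_eq by metis
qed

lemma boundary_vertices_cases: assumes "V \<in> boundary_vertices \<tau>"
  obtains c where "c \<in> flags \<tau>" "V = corner_of ` orb (cross \<tau>) (cross_back \<tau>) c"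
proof -
  obtain t v w where te: "(t, v, w) \<in> corners \<tau>" "V = (corner_pairing \<tau>)\<^sup>* `` {(t, v, w)}"
    using assms by (auto simp: boundary_vertices_def elim!: quotientE)
  then show ?thesis using flag_of_corner[of t v w] that corner_class_eq by (auto simp: corners_def) metis
qed

lemma vertex_class_in_boundary_vertices: assumes "c \<in> flags \<tau>"
  shows "corner_of ` orb (cross \<tau>) (cross_back \<tau>) c \<in> boundary_vertices \<tau>"
proof -
  have "corner_of c \<in> corners \<tau>"
    using assms ccw_less ccw_distinct by (auto simp: flags_def corners_def)
  then show ?thesis unfolding boundary_vertices_def corner_class_eq[OF assms, symmetric] by (rule quotientI)
qed

lemma finite_edges: "finite (edges \<tau>)"
proof -
  have "edges \<tau> \<subseteq> (\<lambda>c. tet_edge ` orb (cross \<tau>) (cross_back \<tau>) c) ` flags \<tau>"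
    using edges_cases by blast
  then show ?thesis using fin finite_surj by blast
qed

lemma card_edge_class: "c \<in> flags \<tau> \<Longrightarrow>
    card (tet_edge ` orb (cross \<tau>) (cross_back \<tau>) c) = card (orb (cross \<tau>) (cross_back \<tau>) c)"
  by (rule card_image) (rule inj_on_tet_edge)

lemma card_orb_le_max_degree: assumes "c \<in> flags \<tau>"
  shows "card (orb (cross \<tau>) (cross_back \<tau>) c) \<le> max_degree \<tau>"
  unfolding max_degree_def card_edge_class[OF assms, symmetric]
  by (rule Max_ge) (use finite_edges edge_class_in_edges[OF assms] in auto)

lemma rotate_corner: assumes "c \<in> flags \<tau>"
  shows "rotate_corner \<tau> (corner_of c) = corner_of (cross \<tau> c)"
proof -
  obtain t v w x y where c: "c = (t, v, w, x, y)" "ccw v w x y"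
    using assms by (auto simp: flags_def)
  have "(THE x. \<exists>y. ccw v w x y) = x"
    using c(2) ccw_unique(1)[OF c(2)] by (intro the_equality) blast+
  then show ?thesis by (simp add: rotate_corner_def c(1))
qed

lemma rotate_corner_pow: assumes "c \<in> flags \<tau>"
  shows "(rotate_corner \<tau> ^^ n) (corner_of c) = corner_of ((cross \<tau> ^^ n) c)"
  using assms by (induction n) (auto simp: rotate_corner closed_pow)

end

text \<open>The deformation telescopes around an edge. In the notation \<open>(v, w, x, y)\<close>, with \<open>X\<close> read as a
  function of edges, the change at a flag is \<open>G (rt c) - G c\<close> for \<open>G c = X(v x) - X(w x)\<close>. The
  other two edges of the face between consecutive flags contribute to both of them with opposite signs.\<close>

section \<open>Angles at flags\<close>

lemma (in oriented_flags) sum_deformation_orb: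
  fixes X :: "'a \<Rightarrow> real"
  assumes "c \<in> K" and inv: "\<And>c. c \<in> K \<Longrightarrow> X (rt c) = X c"
  shows "(\<Sum>c' \<in> orb rt ri c. X (nx (nx c')) + X (nx (nx (rv c'))) - X (nx c') - X (nx (rv c'))) = 0"
proof -
  let ?O = "orb rt ri c"
  define G where "G c' = X (nx c') - X (nx (nx (rv c')))" for c'
  have G_rt: "G (rt c') = X (nx (nx c')) - X (nx (rv c'))" if "c' \<in> ?O" for c'
  proof -
    have K: "c' \<in> K" using that orb_subset[OF assms(1)] by auto
    have "X (nx (rt c')) = X (nx (nx c'))"
      using K inv[of "nx (rt c')"] by (simp add: closed nx_rt rt_ri)
    moreover have "nx (nx (rv (rt c'))) = rt (nx (rv c'))"
      using K nx_nx_ri[of "rv c'"] by (simp add: closed flip: ri_rv)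
    ultimately show ?thesis using K by (simp add: G_def inv closed)
  qed
  have "(\<Sum>c' \<in> ?O. X (nx (nx c')) + X (nx (nx (rv c'))) - X (nx c') - X (nx (rv c')))
      = (\<Sum>c' \<in> ?O. G (rt c')) - (\<Sum>c' \<in> ?O. G c')"
    unfolding sum_subtractf[symmetric] by (rule sum.cong) (simp_all add: G_rt, simp add: G_def)
  also have "(\<Sum>c' \<in> ?O. G (rt c')) = (\<Sum>c' \<in> ?O. G c')"
    by (rule sum.reindex_bij_betw[OF bij_rt_orb[OF assms(1)]])
  finally show ?thesis by simp
qed

definition flag_angle :: "(nat \<Rightarrow> real) \<Rightarrow> flag \<Rightarrow> real" where
  "flag_angle \<alpha> c = edge_angle \<alpha> (tet_edge c)"

lemma flag_angle_simp: "flag_angle \<alpha> (t, v, w, x, y) = \<alpha> (3 * t + opposite_pair {v, w})"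
  by (simp add: flag_angle_def edge_angle_def)

lemma corner_angle_eq: "corner_angle \<alpha> (corner_of c) = flag_angle \<alpha> c"
  by (cases c) (simp add: flag_angle_def corner_angle_def)

lemma flag_angle_triangle:
  assumes "c \<in> flags \<tau>"
  shows "flag_angle \<alpha> c + flag_angle \<alpha> (turn c) + flag_angle \<alpha> (turn (turn c))
    = \<alpha> (3 * fst c) + \<alpha> (3 * fst c + 1) + \<alpha> (3 * fst c + 2)"
proof -
  obtain t v w x y where c: "c = (t, v, w, x, y)" "ccw v w x y" using assms by (auto simp: flags_def)
  show ?thesis
    using opposite_pair_ccw(2)[OF c(2)] by (auto simp: c(1) flag_angle_simp)
qed

lemma pi_before_iff: assumes "c \<in> flags \<tau>"
  shows "pi_before \<alpha> (corner_of c) \<longleftrightarrow> flag_angle \<alpha> (turn (turn c)) = pi"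
proof -
  obtain t v w x y where c: "c = (t, v, w, x, y)" "ccw v w x y" using assms by (auto simp: flags_def)
  have "ccw v x' w y' \<longleftrightarrow> x' = y \<and> y' = x" for x' y'
    using ccw_turn[OF ccw_turn[OF c(2)]] ccw_turn[of v x' w y'] ccw_unique[OF c(2), of y' x'] by blast
  then have "(\<exists>y'. ccw v x' w y') \<longleftrightarrow> x' = y" for x' by simp
  then show ?thesis by (simp add: c(1) pi_before_def flag_angle_simp corner_angle_def edge_angle_def)
qed

lemma pi_after_iff: assumes "c \<in> flags \<tau>"
  shows "pi_after \<alpha> (corner_of c) \<longleftrightarrow> flag_angle \<alpha> (turn c) = pi"
proof -
  obtain t v w x y where c: "c = (t, v, w, x, y)" "ccw v w x y" using assms by (auto simp: flags_def)
  have "ccw v w x' y' \<longleftrightarrow> x' = x \<and> y' = y" for x' y'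
    using ccw_unique[OF c(2), of x' y'] c(2) by blast
  then have "(\<exists>y'. ccw v w x' y') \<longleftrightarrow> x' = x" for x' by simp
  then show ?thesis by (simp add: c(1) pi_after_def flag_angle_simp corner_angle_def edge_angle_def)
qed

section \<open>Veering triangulations\<close>

context
  fixes \<tau> :: triangulation and \<alpha> :: "nat \<Rightarrow> real"
  assumes gluing: "oriented_gluing \<tau>" and veering: "veering_angle_structure \<tau> \<alpha>"
begin

abbreviation "orbit \<equiv> orb (cross \<tau>) (cross_back \<tau>)"

definition is_pi :: "flag \<Rightarrow> bool" where "is_pi c \<longleftrightarrow> flag_angle \<alpha> c = pi"

interpretation oriented_flags "flags \<tau>" turn flip "cross \<tau>" "cross_back \<tau>"
  by (rule oriented_flags[OF gluing])

lemma taut: "taut_angle_structure \<tau> \<alpha>"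
  using veering by (simp add: veering_angle_structure_def)

lemma opposite_pair_less_3: "opposite_pair e < 3"
  by (simp add: opposite_pair_def)

lemma flag_angle_values: assumes "c \<in> flags \<tau>" shows "flag_angle \<alpha> c = (if is_pi c then pi else 0)"
proof -
  obtain t v w x y where c: "c = (t, v, w, x, y)" "t < tets \<tau>" using assms by (auto simp: flags_def)
  have "3 * t + opposite_pair {v, w} < 3 * tets \<tau>"
    using c(2) opposite_pair_less_3[of "{v, w}"] by linarith
  then have "\<alpha> (3 * t + opposite_pair {v, w}) \<in> {0, pi}"
    using taut by (simp add: taut_angle_structure_def)
  then show ?thesis by (auto simp: c(1) is_pi_def flag_angle_simp)
qed

text \<open>The angle sum \<open>\<pi>\<close> of a tetrahedron leaves room for one \<open>\<pi>\<close>-angle, the angle sum \<open>2 \<pi>\<close> of an edge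
  for two. The latter uses that distinct flags of an orbit lie on distinct tetrahedron edges.\<close>
lemma taut_flags: "taut_flags (flags \<tau>) turn flip (cross \<tau>) (cross_back \<tau>) is_pi"
proof
  fix c assume K: "c \<in> flags \<tau>"
  then obtain t v w x y where c: "c = (t, v, w, x, y)" "t < tets \<tau>" "ccw v w x y"
    by (auto simp: flags_def)
  show "is_pi (flip c) = is_pi c" by (simp add: is_pi_def c(1) flag_angle_simp insert_commute)
  show "is_pi (turn (turn (flip (turn c)))) = is_pi c"
    using opposite_pair_ccw(1)[OF c(3)] by (simp add: is_pi_def c(1) flag_angle_simp)
  have "flag_angle \<alpha> c + flag_angle \<alpha> (turn c) + flag_angle \<alpha> (turn (turn c)) = pi"
    using taut c(2) unfolding flag_angle_triangle[OF K]
    by (simp add: c(1) taut_angle_structure_def generalized_angle_structure_def)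
  then have sum: "(if is_pi c then pi else 0) + (if is_pi (turn c) then pi else 0)
      + (if is_pi (turn (turn c)) then pi else 0) = pi"
    using K by (simp add: flag_angle_values closed)
  show "is_pi c \<or> is_pi (turn c) \<or> is_pi (turn (turn c))" using sum by (auto split: if_splits)
  show "\<not> is_pi (turn c)" if "is_pi c"
    using sum that pi_gt_zero by (auto split: if_splits)
  have "(\<Sum>c' \<in> orbit c. flag_angle \<alpha> c') = (\<Sum>e \<in> tet_edge ` orbit c. edge_angle \<alpha> e)"
    using inj_on_tet_edge[OF gluing K] by (simp add: sum.reindex flag_angle_def)
  also have "\<dots> = 2 * pi"
    using edge_class_in_edges[OF gluing K] taut
    by (simp add: taut_angle_structure_def generalized_angle_structure_def)
  also have "(\<Sum>c' \<in> orbit c. flag_angle \<alpha> c') = (\<Sum>c' \<in> orbit c. if is_pi c' then pi else 0)"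
    using orb_subset[OF K] by (intro sum.cong) (auto simp: flag_angle_values)
  also have "\<dots> = (\<Sum>c' \<in> {c' \<in> orbit c. is_pi c'}. pi)"
    by (rule sum.inter_filter[symmetric]) (rule finite_orb[OF K])
  finally have "real (card {c' \<in> orbit c. is_pi c'}) * pi = 2 * pi" by simp
  then have "real (card {c' \<in> orbit c. is_pi c'}) = real 2" using pi_gt_zero by simp
  then show "card {c' \<in> orbit c. is_pi c'} = 2" by (rule of_nat_eq_iff[THEN iffD1])
qed

interpretation taut_flags "flags \<tau>" turn flip "cross \<tau>" "cross_back \<tau>" is_pi
  by (rule taut_flags)

lemma fan_from_flag:
  assumes c0: "c0 \<in> flags \<tau>" "is_pi c0" "is_pi ((cross \<tau> ^^ Suc d) c0)"
    and zero: "\<And>i. 1 \<le> i \<Longrightarrow> i \<le> d \<Longrightarrow> \<not> is_pi ((cross \<tau> ^^ i) c0)"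
  shows "map (\<lambda>i. corner_of ((cross \<tau> ^^ i) c0)) [1..<Suc d] \<in> fans \<tau> \<alpha> (corner_of ` orbit c0)"
  unfolding fans_def mem_Collect_eq
proof (intro exI conjI ballI)
  show "map (\<lambda>i. corner_of ((cross \<tau> ^^ i) c0)) [1..<Suc d]
      = map (\<lambda>i. (rotate_corner \<tau> ^^ i) (corner_of c0)) [1..<Suc d]"
    by (simp add: rotate_corner_pow[OF gluing c0(1)])
  show "corner_of c0 \<in> corner_of ` orbit c0" using orb_self by blast
  show "corner_angle \<alpha> (corner_of c0) = pi" using c0(2) by (simp add: corner_angle_eq is_pi_def)
  show "corner_angle \<alpha> ((rotate_corner \<tau> ^^ Suc d) (corner_of c0)) = pi"
    unfolding rotate_corner_pow[OF gluing c0(1)] corner_angle_eq using c0(3) by (simp add: is_pi_def)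
  fix i assume "i \<in> {1..d}"
  then show "corner_angle \<alpha> ((rotate_corner \<tau> ^^ i) (corner_of c0)) = 0"
    unfolding rotate_corner_pow[OF gluing c0(1)] corner_angle_eq
    using zero[of i] c0(1) flag_angle_values closed_pow by auto
qed

lemma zero_flag_in_fan:
  assumes "c \<in> flags \<tau>" "\<not> is_pi c"
  obtains F where "F \<in> fans \<tau> \<alpha> (corner_of ` orbit c)" "corner_of c \<in> set F"
proof -
  have zero: "\<not> is_pi ((cross \<tau> ^^ a) c)" if "a \<le> 0" for a using that assms(2) by simp
  obtain c0 d n where c0: "c0 \<in> orbit c" "is_pi c0" "is_pi ((cross \<tau> ^^ Suc d) c0)"
      "\<And>i. 1 \<le> i \<Longrightarrow> i \<le> d \<Longrightarrow> \<not> is_pi ((cross \<tau> ^^ i) c0)" "1 \<le> n" "n \<le> d" "(cross \<tau> ^^ n) c0 = c"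
    using zero_run_in_fan[OF assms(1) zero] by blast
  have K: "c0 \<in> flags \<tau>" using c0(1) orb_subset[OF assms(1)] by blast
  have "n \<in> set [1..<Suc d]" using c0(5,6) by (simp only: set_upt atLeastLessThan_iff less_Suc_eq_le)
  then have "corner_of c \<in> set (map (\<lambda>i. corner_of ((cross \<tau> ^^ i) c0)) [1..<Suc d])"
    unfolding set_map c0(7)[symmetric] by (rule imageI)
  then show ?thesis
    using that fan_from_flag[OF K c0(2-4)] orb_eq[OF assms(1) c0(1)] by auto
qed

text \<open>\<open>turn\<close> has order 3, so \<open>turn (turn c)\<close> is the corner before \<open>c\<close>. The witness may be
  any 0-angled corner, since veering makes them all agree.\<close>
definition red_flag :: "flag \<Rightarrow> bool" where
  "red_flag c \<longleftrightarrow> (\<exists>c' \<in> orbit c. \<not> is_pi c' \<and> is_pi (turn (turn c')))"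

lemma veering_flags: "veering_flags (flags \<tau>) turn flip (cross \<tau>) (cross_back \<tau>) is_pi red_flag"
proof
  fix c assume K: "c \<in> flags \<tau>"
  show "red_flag (cross \<tau> c) = red_flag c"
    unfolding red_flag_def orb_eq[OF K orb_rt[OF K orb_self]] ..
  have flip: "is_pi (turn (turn (flip z))) = is_pi (turn (turn z))" if "z \<in> flags \<tau>" for z
  proof -
    obtain t v w x y where z: "z = (t, v, w, x, y)" "ccw v w x y" using \<open>z \<in> flags \<tau>\<close> by (auto simp: flags_def)
    show ?thesis
      using opposite_pair_ccw(1)[OF ccw_turn[OF ccw_turn[OF z(2)]]]
      by (simp add: z(1) is_pi_def flag_angle_simp insert_commute)
  qed
  have "red_flag (flip c) \<longleftrightarrow> (\<exists>c' \<in> orbit c. \<not> is_pi (flip c') \<and> is_pi (turn (turn (flip c'))))"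
    unfolding red_flag_def orb_rv[OF K] by (rule bex_simps)
  also have "\<dots> \<longleftrightarrow> red_flag c"
    unfolding red_flag_def
  proof (rule bex_cong[OF refl])
    fix c' assume "c' \<in> orbit c"
    then have "c' \<in> flags \<tau>" using orb_subset[OF K] by blast
    then show "(\<not> is_pi (flip c') \<and> is_pi (turn (turn (flip c')))) = (\<not> is_pi c' \<and> is_pi (turn (turn c')))"
      by (simp only: P_rv flip)
  qed
  finally show "red_flag (flip c) = red_flag c" .
  assume zero: "\<not> is_pi c"
  have same: "is_pi (turn (turn c')) \<longleftrightarrow> is_pi (turn (turn c))" if c': "c' \<in> orbit c" "\<not> is_pi c'" for c'
  proof -
    have K': "c' \<in> flags \<tau>" using c'(1) orb_subset[OF K] by blast
    let ?V = "corner_of ` orbit c"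
    obtain F where F: "F \<in> fans \<tau> \<alpha> ?V" "corner_of c \<in> set F"
      using zero_flag_in_fan[OF K zero] .
    obtain F' where F': "F' \<in> fans \<tau> \<alpha> ?V" "corner_of c' \<in> set F'"
      using zero_flag_in_fan[OF K' c'(2)] unfolding orb_eq[OF K c'(1)] .
    have "?V \<in> boundary_vertices \<tau>" by (rule vertex_class_in_boundary_vertices[OF gluing K])
    then have "(\<forall>F\<in>fans \<tau> \<alpha> ?V. \<forall>k\<in>set F. pi_before \<alpha> k) \<or> (\<forall>F\<in>fans \<tau> \<alpha> ?V. \<forall>k\<in>set F. pi_after \<alpha> k)"
      using veering unfolding veering_angle_structure_def by (elim conjE) (rule bspec)
    then have "(is_pi (turn (turn c)) \<and> is_pi (turn (turn c'))) \<or> (is_pi (turn c) \<and> is_pi (turn c'))"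
      using F F' unfolding is_pi_def pi_before_iff[OF K, symmetric] pi_before_iff[OF K', symmetric]
        pi_after_iff[OF K, symmetric] pi_after_iff[OF K', symmetric] by blast
    then show ?thesis
      using P_unique[OF closed(1)[OF K]] P_unique[OF closed(1)[OF K']] by blast
  qed
  show "red_flag c = is_pi (turn (turn c))"
    unfolding red_flag_def using same zero orb_self[of c] by blast
qed

interpretation veering_flags "flags \<tau>" turn flip "cross \<tau>" "cross_back \<tau>" is_pi red_flag
  by (rule veering_flags)

lemma fan_cases:
  assumes "V \<in> boundary_vertices \<tau>" "F \<in> fans \<tau> \<alpha> V"
  obtains c where "c \<in> flags \<tau>" "length F + 3 \<le> card (orbit c)"
proof -
  obtain b where b: "b \<in> flags \<tau>" "V = corner_of ` orbit b"
    using boundary_vertices_cases[OF gluing assms(1)] .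
  obtain k d where k: "k \<in> V" "corner_angle \<alpha> k = pi"
      "corner_angle \<alpha> ((rotate_corner \<tau> ^^ Suc d) k) = pi"
      "\<forall>i\<in>{1..d}. corner_angle \<alpha> ((rotate_corner \<tau> ^^ i) k) = 0" "length F = d"
    using assms(2) unfolding fans_def by auto
  then obtain c where c: "c \<in> orbit b" "k = corner_of c" using b(2) by blast
  have K: "c \<in> flags \<tau>" using c(1) orb_subset[OF b(1)] by blast
  have "d + 3 \<le> card (orbit c)"
  proof (rule fan_length_le_degree[OF K])
    show "is_pi c" "is_pi ((cross \<tau> ^^ Suc d) c)"
      using k(2,3) unfolding c(2) rotate_corner_pow[OF gluing K] corner_angle_eq
      by (simp_all add: is_pi_def)
    fix i assume "1 \<le> i" "i \<le> d"
    then show "\<not> is_pi ((cross \<tau> ^^ i) c)"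
      using k(4) unfolding c(2) rotate_corner_pow[OF gluing K] corner_angle_eq
      by (simp add: is_pi_def)
  qed
  then show ?thesis using that K k(5) by auto
qed

definition fan_lengths :: "nat set" where
  "fan_lengths = {length F | F V. V \<in> boundary_vertices \<tau> \<and> F \<in> fans \<tau> \<alpha> V}"

lemma max_fan_eq: "max_fan \<tau> \<alpha> = Max fan_lengths"
  by (simp add: max_fan_def fan_lengths_def)

lemma finite_fan_lengths: "finite fan_lengths"
proof (rule finite_subset)
  show "fan_lengths \<subseteq> {..max_degree \<tau>}"
  proof
    fix n assume "n \<in> fan_lengths"
    then obtain F V where F: "n = length F" "V \<in> boundary_vertices \<tau>" "F \<in> fans \<tau> \<alpha> V"
      by (auto simp: fan_lengths_def)
    then obtain c where c: "c \<in> flags \<tau>" "length F + 3 \<le> card (orbit c)" using fan_cases by blast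
    then show "n \<in> {..max_degree \<tau>}" using card_orb_le_max_degree[OF gluing c(1)] F(1) by simp
  qed
qed simp

lemma zero_run_less_max_fan:
  assumes c: "c \<in> flags \<tau>" and zero: "\<And>a. a \<le> k \<Longrightarrow> \<not> is_pi ((cross \<tau> ^^ a) c)"
  shows "k < max_fan \<tau> \<alpha>"
proof -
  obtain c0 d n where c0: "c0 \<in> orbit c" "k < d" "is_pi c0" "is_pi ((cross \<tau> ^^ Suc d) c0)"
      "\<And>i. 1 \<le> i \<Longrightarrow> i \<le> d \<Longrightarrow> \<not> is_pi ((cross \<tau> ^^ i) c0)" "1 \<le> n" "n \<le> d" "(cross \<tau> ^^ n) c0 = c"
    using zero_run_in_fan[OF c, of k] zero by blast
  have K: "c0 \<in> flags \<tau>" using c0(1) orb_subset[OF c] by blast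
  have "d \<in> fan_lengths"
    unfolding fan_lengths_def
    using fan_from_flag[OF K c0(3-5)] vertex_class_in_boundary_vertices[OF gluing K] by force
  then have "d \<le> Max fan_lengths" by (rule Max_ge[OF finite_fan_lengths])
  then show ?thesis using c0(2) by (simp add: max_fan_eq)
qed

lemma ex_zero_flag: assumes "flags \<tau> \<noteq> {}" obtains z where "z \<in> flags \<tau>" "\<not> is_pi z"
proof -
  obtain c where c: "c \<in> flags \<tau>" using assms by blast
  show ?thesis using P_unique[OF c] closed(1)[OF c] c that by blast
qed

lemma max_fan_pos: assumes "flags \<tau> \<noteq> {}" shows "0 < max_fan \<tau> \<alpha>"
proof -
  obtain z where z: "z \<in> flags \<tau>" "\<not> is_pi z" using ex_zero_flag[OF assms] .
  show ?thesis by (rule zero_run_less_max_fan[OF z(1)]) (use z(2) in simp)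
qed

lemma max_fan_le_max_degree: assumes "flags \<tau> \<noteq> {}" shows "max_fan \<tau> \<alpha> + 3 \<le> max_degree \<tau>"
proof -
  obtain z where z: "z \<in> flags \<tau>" "\<not> is_pi z" using ex_zero_flag[OF assms] .
  obtain F where "F \<in> fans \<tau> \<alpha> (corner_of ` orbit z)" using zero_flag_in_fan[OF z] .
  then have "fan_lengths \<noteq> {}"
    using vertex_class_in_boundary_vertices[OF gluing z(1)] by (auto simp: fan_lengths_def)
  then have "max_fan \<tau> \<alpha> \<in> fan_lengths" unfolding max_fan_eq by (rule Max_in[OF finite_fan_lengths])
  then obtain F V where F: "max_fan \<tau> \<alpha> = length F" "V \<in> boundary_vertices \<tau>" "F \<in> fans \<tau> \<alpha> V"
    by (auto simp: fan_lengths_def)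
  then obtain c' where c': "c' \<in> flags \<tau>" "length F + 3 \<le> card (orbit c')" using fan_cases by blast
  then show ?thesis using card_orb_le_max_degree[OF gluing c'(1)] F(1) by simp
qed

lemma veering_edge_weights:
  obtains X :: "flag \<Rightarrow> real" where
    "\<And>c. c \<in> flags \<tau> \<Longrightarrow> X (cross \<tau> c) = X c" "\<And>c. c \<in> flags \<tau> \<Longrightarrow> X (flip c) = X c"
    "\<And>c. c \<in> flags \<tau> \<Longrightarrow> (if is_pi c then - 8 * (real (max_fan \<tau> \<alpha>))\<^sup>2 else 1)
       \<le> X (turn (turn c)) + X (turn (turn (flip c))) - X (turn c) - X (turn (flip c))"
proof -
  interpret veering_flags_fan_bound "flags \<tau>" turn flip "cross \<tau>" "cross_back \<tau>" is_pi red_flag "max_fan \<tau> \<alpha>"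
    by unfold_locales (rule zero_run_less_max_fan)
  show ?thesis using edge_weights_exist that by blast
qed

end

section \<open>The positive angle structure\<close>

definition deformation :: "(flag \<Rightarrow> real) \<Rightarrow> flag \<Rightarrow> real" where
  "deformation X c = X (turn (turn c)) + X (turn (turn (flip c))) - X (turn c) - X (turn (flip c))"

lemma exists_flag_of_pair: assumes "t < tets \<tau>" "k < 3"
  shows "\<exists>v w x y. (t, v, w, x, y) \<in> flags \<tau> \<and> opposite_pair {v, w} = k"
proof -
  have K: "(t, 0, 1, 2, 3) \<in> flags \<tau>" "(t, 0, 2, 3, 1) \<in> flags \<tau>" "(t, 0, 3, 1, 2) \<in> flags \<tau>"
    unfolding flags_def mem_Collect_eq case_prod_conv
    using assms(1) ccw_0123 ccw_turn[OF ccw_0123] ccw_turn[OF ccw_turn[OF ccw_0123]] by simp_all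
  consider "k = 0" | "k = 1" | "k = 2" using assms(2) by linarith
  then have "k = opposite_pair {0, 1} \<or> k = opposite_pair {0, 2} \<or> k = opposite_pair {0, 3}"
    by cases (simp_all only: opposite_pair_simps simp_thms)
  then show ?thesis using K by blast
qed

context
  fixes \<tau> :: triangulation and X :: "flag \<Rightarrow> real"
  assumes gluing: "oriented_gluing \<tau>"
    and X_cross: "\<And>c. c \<in> flags \<tau> \<Longrightarrow> X (cross \<tau> c) = X c"
    and X_flip: "\<And>c. c \<in> flags \<tau> \<Longrightarrow> X (flip c) = X c"
begin

interpretation oriented_flags "flags \<tau>" turn flip "cross \<tau>" "cross_back \<tau>"
  by (rule oriented_flags[OF gluing])

lemma X_reverse:
  assumes "(t, v, w, x, y) \<in> flags \<tau>" shows "X (t, w, v, y, x) = X (t, v, w, x, y)"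
  using X_flip[OF assms] by simp

lemma deformation_flip: "c \<in> flags \<tau> \<Longrightarrow> deformation X (flip c) = deformation X c"
  by (simp add: deformation_def rv2)

lemma deformation_opposite:
  assumes "(t, v, w, x, y) \<in> flags \<tau>"
  shows "deformation X (t, x, y, v, w) = deformation X (t, v, w, x, y)"
proof -
  have "(t, v, x, y, w) \<in> flags \<tau>" "(t, v, y, w, x) \<in> flags \<tau>" "(t, w, x, v, y) \<in> flags \<tau>" "(t, w, y, x, v) \<in> flags \<tau>"
    using closed(1)[OF assms] closed(1)[OF closed(1)[OF assms]] closed(1)[OF closed(2)[OF assms]]
      closed(1)[OF closed(1)[OF closed(2)[OF assms]]] by simp_all
  from this[THEN X_reverse] show ?thesis by (simp add: deformation_def)
qed

lemma deformation_triangle: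
  assumes "c \<in> flags \<tau>"
  shows "deformation X c + deformation X (turn c) + deformation X (turn (turn c)) = 0"
proof -
  obtain t v w x y where c: "c = (t, v, w, x, y)" by (metis prod_cases5)
  note K = assms[unfolded c]
  have "(t, x, y, v, w) \<in> flags \<tau>" "(t, w, x, v, y) \<in> flags \<tau>" "(t, w, y, x, v) \<in> flags \<tau>"
    using closed(1)[OF closed(1)[OF closed(2)[OF closed(1)[OF K]]]] closed(1)[OF closed(2)[OF K]]
      closed(1)[OF closed(1)[OF closed(2)[OF K]]] by simp_all
  from this[THEN X_reverse] show ?thesis by (simp add: deformation_def c)
qed

lemma deformation_orbit:
  "c \<in> flags \<tau> \<Longrightarrow> (\<Sum>c' \<in> orb (cross \<tau>) (cross_back \<tau>) c. deformation X c') = 0"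
  unfolding deformation_def by (rule sum_deformation_orb) (auto intro: X_cross)

text \<open>The deformation is one function of the three pairs of opposite edges: the flags on a pair are
  \<open>c\<close>, its opposite and their reversals.\<close>
lemma deformation_same_pair:
  assumes "(t, v, w, x, y) \<in> flags \<tau>" "(t, v', w', x', y') \<in> flags \<tau>"
    "opposite_pair {v', w'} = opposite_pair {v, w}"
  shows "deformation X (t, v', w', x', y') = deformation X (t, v, w, x, y)"
proof -
  have ccw: "ccw v w x y" "ccw v' w' x' y'" using assms by (auto simp: flags_def)
  have xyvw: "ccw x y v w" using ccw_turn[OF ccw_turn[OF ccw_flip[OF ccw_turn[OF ccw(1)]]]] .
  have K: "(t, x, y, v, w) \<in> flags \<tau>" using xyvw assms(1) by (simp add: flags_def)
  have "(v', w') \<in> {(v, w), (w, v), (x, y), (y, x)}"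
    using opposite_pair_eq_iff[OF ccw(1) ccw_less(1,2)[OF ccw(2)] ccw_distinct(1)[OF ccw(2)] assms(3)] .
  then have "v' = v \<and> w' = w \<or> v' = w \<and> w' = v \<or> v' = x \<and> w' = y \<or> v' = y \<and> w' = x"
    by (simp only: insert_iff empty_iff prod.inject simp_thms)
  then show ?thesis
  proof (elim disjE conjE)
    assume same: "v' = v" "w' = w"
    show ?thesis unfolding same ccw_unique[OF ccw(1) ccw(2)[unfolded same]] ..
  next
    assume swap: "v' = w" "w' = v"
    show ?thesis
      unfolding swap ccw_unique[OF ccw_flip[OF ccw(1)] ccw(2)[unfolded swap]]
      using deformation_flip[OF assms(1)] unfolding flip.simps .
  next
    assume op: "v' = x" "w' = y"
    show ?thesis
      unfolding op ccw_unique[OF xyvw ccw(2)[unfolded op]] by (rule deformation_opposite[OF assms(1)])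
  next
    assume flip_op: "v' = y" "w' = x"
    show ?thesis
      unfolding flip_op ccw_unique[OF ccw_flip[OF xyvw] ccw(2)[unfolded flip_op]]
      using deformation_flip[OF K] unfolding flip.simps deformation_opposite[OF assms(1)] .
  qed
qed

text \<open>The coordinate \<open>j = 3 t + k\<close> belongs to the \<open>k\<close>-th pair of opposite edges of tetrahedron \<open>t\<close>,
  and any flag on this pair may be used to evaluate the deformation.\<close>
definition deformed :: "real \<Rightarrow> (nat \<Rightarrow> real) \<Rightarrow> nat \<Rightarrow> real" where
  "deformed s \<alpha> j = \<alpha> j + s * deformation X
     (SOME c. c \<in> flags \<tau> \<and> fst c = j div 3 \<and> opposite_pair (snd (tet_edge c)) = j mod 3)"

lemma flag_angle_deformed:
  assumes "c \<in> flags \<tau>"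
  shows "flag_angle (deformed s \<alpha>) c = flag_angle \<alpha> c + s * deformation X c"
proof -
  obtain t v w x y where c: "c = (t, v, w, x, y)" by (metis prod_cases5)
  let ?j = "3 * t + opposite_pair {v, w}"
  let ?Q = "\<lambda>c. c \<in> flags \<tau> \<and> fst c = ?j div 3 \<and> opposite_pair (snd (tet_edge c)) = ?j mod 3"
  have "opposite_pair {v, w} < 3" by (simp add: opposite_pair_def)
  then have j: "?j div 3 = t" "?j mod 3 = opposite_pair {v, w}" by simp_all
  define d where "d = (SOME c. ?Q c)"
  have "?Q c" unfolding j using assms by (simp add: c)
  then have Qd: "?Q d" unfolding d_def by (rule someI[of ?Q])
  obtain t' v' w' x' y' where d: "d = (t', v', w', x', y')" by (metis prod_cases5)
  have "t' = t" "opposite_pair {v', w'} = opposite_pair {v, w}"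
    using Qd unfolding j d by (simp_all only: fst_conv snd_conv tet_edge.simps)
  then have "deformation X d = deformation X c"
    using deformation_same_pair[of t v w x y v' w' x' y'] assms Qd unfolding c d by blast
  then show ?thesis unfolding c flag_angle_simp deformed_def d_def by (simp only:)
qed

lemma generalized_angle_structure_deformed:
  assumes "generalized_angle_structure \<tau> \<alpha>"
  shows "generalized_angle_structure \<tau> (deformed s \<alpha>)"
  unfolding generalized_angle_structure_def
proof (intro conjI allI ballI impI)
  fix t assume "t < tets \<tau>"
  then obtain v w x y where "(t, v, w, x, y) \<in> flags \<tau>" using exists_flag_of_pair[of t \<tau> 0] by auto
  then obtain c where c: "c \<in> flags \<tau>" "fst c = t" by fastforce
  have K: "turn c \<in> flags \<tau>" "turn (turn c) \<in> flags \<tau>" using c by (auto simp: closed)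
  have "deformed s \<alpha> (3 * t) + deformed s \<alpha> (3 * t + 1) + deformed s \<alpha> (3 * t + 2)
      = (\<alpha> (3 * t) + \<alpha> (3 * t + 1) + \<alpha> (3 * t + 2))
        + s * (deformation X c + deformation X (turn c) + deformation X (turn (turn c)))"
    using flag_angle_triangle[OF c(1), of "deformed s \<alpha>"] flag_angle_triangle[OF c(1), of \<alpha>]
      flag_angle_deformed[OF c(1)] flag_angle_deformed[OF K(1)] flag_angle_deformed[OF K(2)] c(2)
    by (simp add: algebra_simps)
  then show "deformed s \<alpha> (3 * t) + deformed s \<alpha> (3 * t + 1) + deformed s \<alpha> (3 * t + 2) = pi"
    using deformation_triangle[OF c(1)] assms \<open>t < tets \<tau>\<close> by (simp add: generalized_angle_structure_def)
next
  fix E assume E: "E \<in> edges \<tau>"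
  then obtain c where c: "c \<in> flags \<tau>" "E = tet_edge ` orb (cross \<tau>) (cross_back \<tau>) c"
    using edges_cases[OF gluing] by metis
  let ?O = "orb (cross \<tau>) (cross_back \<tau>) c"
  have sum_E: "(\<Sum>e\<in>E. edge_angle \<beta> e) = (\<Sum>c'\<in>?O. flag_angle \<beta> c')" for \<beta>
    unfolding c(2) using inj_on_tet_edge[OF gluing c(1)] by (simp add: sum.reindex flag_angle_def)
  have "(\<Sum>e\<in>E. edge_angle (deformed s \<alpha>) e) = (\<Sum>c'\<in>?O. flag_angle \<alpha> c' + s * deformation X c')"
    unfolding sum_E by (rule sum.cong) (use orb_subset[OF c(1)] flag_angle_deformed in auto)
  also have "\<dots> = (\<Sum>e\<in>E. edge_angle \<alpha> e) + s * (\<Sum>c'\<in>?O. deformation X c')"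
    unfolding sum_E by (simp add: sum.distrib sum_distrib_left)
  also have "\<dots> = 2 * pi"
    using deformation_orbit[OF c(1)] assms E by (simp add: generalized_angle_structure_def)
  finally show "(\<Sum>e\<in>E. edge_angle (deformed s \<alpha>) e) = 2 * pi" .
qed

end

theorem theorem1p4:
  fixes \<tau> :: triangulation and \<alpha> :: "nat \<Rightarrow> real"
  assumes "veering_triangulation \<tau> \<alpha>"
  shows "\<exists>\<theta>. positive_angle_structure \<tau> \<theta> \<and>
     (\<forall>i<3 * tets \<tau>.
        \<theta> i \<ge> pi / (12 * (real (max_fan \<tau> \<alpha>))\<^sup>2) \<and>
        pi / (12 * (real (max_fan \<tau> \<alpha>))\<^sup>2) \<ge> pi / (12 * (real (max_degree \<tau>) - 3)\<^sup>2))"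
proof -
  have gluing: "oriented_gluing \<tau>" and veering: "veering_angle_structure \<tau> \<alpha>"
    using assms by (auto simp: veering_triangulation_def ideal_triangulation_def)
  interpret oriented_flags "flags \<tau>" turn flip "cross \<tau>" "cross_back \<tau>"
    by (rule oriented_flags[OF gluing])
  have gas: "generalized_angle_structure \<tau> \<alpha>"
    using veering by (simp add: veering_angle_structure_def taut_angle_structure_def)
  let ?N = "real (max_fan \<tau> \<alpha>)" and ?e = "real (max_degree \<tau>) - 3"
  define s where "s = pi / (12 * ?N\<^sup>2)"
  obtain X where X_cross: "\<And>c. c \<in> flags \<tau> \<Longrightarrow> X (cross \<tau> c) = X c"
    and X_flip: "\<And>c. c \<in> flags \<tau> \<Longrightarrow> X (flip c) = X c"
    and X_ge: "\<And>c. c \<in> flags \<tau> \<Longrightarrow>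
      (if is_pi \<alpha> c then - 8 * ?N\<^sup>2 else 1)
        \<le> X (turn (turn c)) + X (turn (turn (flip c))) - X (turn c) - X (turn (flip c))"
    using veering_edge_weights[OF gluing veering] by blast
  let ?\<theta> = "deformed \<tau> X s \<alpha>"
  have bounds: "s \<le> ?\<theta> j \<and> 0 < s \<and> s \<ge> pi / (12 * ?e\<^sup>2)" if j: "j < 3 * tets \<tau>" for j
  proof -
    have "j div 3 < tets \<tau>" "j mod 3 < 3" using j by auto
    then obtain v w x y where c: "(j div 3, v, w, x, y) \<in> flags \<tau>" "opposite_pair {v, w} = j mod 3"
      using exists_flag_of_pair[of "j div 3" \<tau> "j mod 3"] by blast
    let ?c = "(j div 3, v, w, x, y)"
    have angle_j: "flag_angle \<beta> ?c = \<beta> j" for \<beta> by (simp add: flag_angle_simp c(2))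
    have \<theta>: "?\<theta> j = flag_angle \<alpha> ?c + s * deformation X ?c"
      using flag_angle_deformed[OF gluing X_cross X_flip c(1), of s \<alpha>] by (simp add: angle_j)
    have ge: "(if is_pi \<alpha> ?c then - 8 * ?N\<^sup>2 else 1) \<le> deformation X ?c"
      unfolding deformation_def by (rule X_ge[OF c(1)])
    have ne: "flags \<tau> \<noteq> {}" using c(1) by blast
    have pos_N: "0 < max_fan \<tau> \<alpha>" by (rule max_fan_pos[OF gluing veering ne])
    have "?N \<le> ?e" using max_fan_le_max_degree[OF gluing veering ne] by linarith
    then have "?N\<^sup>2 \<le> ?e\<^sup>2" by (intro power_mono) simp_all
    moreover have N2: "1 \<le> ?N\<^sup>2" using pos_N by simp
    ultimately have e: "s \<ge> pi / (12 * ?e\<^sup>2)"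
      unfolding s_def using pos_N by (intro frac_le) simp_all
    have s: "0 < s" unfolding s_def using pos_N by simp
    have sN: "s * (12 * ?N\<^sup>2) = pi" unfolding s_def using pos_N by simp
    show ?thesis
    proof (cases "is_pi \<alpha> ?c")
      case True
      have "s * (- 8 * ?N\<^sup>2) \<le> s * deformation X ?c"
        using ge True s by (intro mult_left_mono) simp_all
      then have "- 8 * (s * ?N\<^sup>2) \<le> s * deformation X ?c" by (simp add: algebra_simps)
      moreover have "s * 1 \<le> s * ?N\<^sup>2" using s N2 by (intro mult_left_mono) simp_all
      moreover have "12 * (s * ?N\<^sup>2) = pi" using sN by (simp add: algebra_simps)
      moreover have "flag_angle \<alpha> ?c = pi" using True by (simp add: is_pi_def[OF gluing veering])
      ultimately show ?thesis using \<theta> s e by linarith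
    next
      case False
      have "s * 1 \<le> s * deformation X ?c"
        using ge False s by (intro mult_left_mono) simp_all
      then show ?thesis
        using \<theta> s e False flag_angle_values[OF gluing veering c(1)] by simp
    qed
  qed
  have "positive_angle_structure \<tau> ?\<theta>"
    using generalized_angle_structure_deformed[OF gluing X_cross X_flip gas] bounds
    unfolding positive_angle_structure_def by (meson less_le_trans)
  then show ?thesis using bounds unfolding s_def by blast
qed

end
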